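(* There exists an absolute constant $\alpha>0$ such that for every integer $n\ge 1$ $$\alpha\sqrt n\le \sup_{R\in\mathcal{RU}_{n,1}}\ell(R)\le 6\pi\sqrt n .$$ Consequently $\gamma_0=1/2$, where $$\gamma_0=\limsup_{n\to\infty}\ \sup_{R\in\mathcal{RU}_{n,1}}\frac{\log \ell(R)}{\log n}.$$
   Context: $\mathbb D=\{z\in\mathbb C:|z|<1\}$, $\mathbb T=\partial\mathbb D$. For a positive integer $n$, $\mathcal{RU}_{n,1}$ is the set of all rational functions $R=P/Q$, where $P,Q$ are complex polynomials of degree at most $n$, such that $R$ has no poles in $\overline{\mathbb D}$, $R$ is univalent (injective) in $\mathbb D$, and $\sup_{\zeta\in\mathbb T}|R(\zeta)|\le 1$. For such $R$, $\ell(R)=\dfrac1{2\pi}\displaystyle\int_{\mathbb T}|R'(\zeta)|\,|d\zeta|$. *)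

theory Defs
  imports "HOL-Complex_Analysis.Complex_Analysis"
begin

(* A rational function is represented as a total function given by a fraction in lowest terms.
   Coprimality ensures that no removable singularity is turned into a spurious value 0 by the
   convention x / 0 = 0; that convention only takes effect at the poles of R. *)
definition rational_fun_of_degree_le :: "nat \<Rightarrow> (complex \<Rightarrow> complex) \<Rightarrow> bool" where
  "rational_fun_of_degree_le n R \<longleftrightarrow>
     (\<exists>P Q :: complex poly. Q \<noteq> 0 \<and> coprime P Q \<and> degree P \<le> n \<and> degree Q \<le> n \<and>
        R = (\<lambda>z. poly P z / poly Q z))"

(* The real supremum is over a nonempty set that is bounded, since the other conditions make R
   continuous on the unit circle. *)
definition RU1 :: "nat \<Rightarrow> (complex \<Rightarrow> complex) set" where
  "RU1 n = {R. rational_fun_of_degree_le n R \<and>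
               (\<forall>z\<in>cball 0 1. \<not> is_pole R z) \<and>
               inj_on R (ball 0 1) \<and>
               (SUP \<zeta>\<in>sphere 0 1. cmod (R \<zeta>)) \<le> 1}"

(* Arc length integral over the unit circle, parametrised by \<zeta> = cis t, |d\<zeta>| = dt. *)
definition ell :: "(complex \<Rightarrow> complex) \<Rightarrow> real" where
  "ell R = 1 / (2 * pi) * integral {0..2 * pi} (\<lambda>t. cmod (deriv R (cis t)))"

(* Suprema and limsup are taken in the extended reals, so that they are meaningful without a
   priori bounds. The value at n = 1, where ln n = 0, does not affect the limsup. *)
definition gamma0 :: ereal where
  "gamma0 = limsup (\<lambda>n. SUP R\<in>RU1 n. ereal (ln (ell R) / ln (real n)))"

end

theory Submission
  imports Defs "HOL-Computational_Algebra.Fundamental_Theorem_Algebra"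
begin

text \<open>
  The upper bound is an area argument.  Let \<open>R\<close> be rational of degree at most \<open>n\<close> without poles in the
  closed disc, and let \<open>B\<close> be the Blaschke product whose \<open>n\<close> zeros are the reflections of the finite poles
  of \<open>R\<close>, filled up with zeros at the origin, which account for a pole at infinity.  On the
  circle the function \<open>cnj R \<cdot> B\<close> has a holomorphic extension to the disc.  Hence \<open>R'\<close> is orthogonal, in the Bergman space, to all multiples
  of \<open>B\<close>, and the Bergman kernel may be replaced by the square of the Hardy space kernel
  \<open>k w z = (1 - cnj (B w) * B z) / (1 - cnj w * z)\<close>, which stays bounded if both arguments approach the same point of the circle:
  \<open>\<pi> * R' w = \<integral> R' z * cnj (k w z)^2 dA z\<close> for all \<open>w\<close> in the disc
  (\<open>reproducing_formula\<close>, proved with Green's formula in polar coordinates).  The mean of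
  \<open>\<bar>k w z\<bar>^2\<close> over the circle \<open>\<bar>w\<bar> = 1\<close> is
  \<open>\<delta> z = (1 - \<bar>B z\<bar>^2) / (1 - \<bar>z\<bar>^2)\<close>, so that
  \<open>\<integral> \<bar>R'\<bar> dt \<le> 2 * \<integral> \<bar>R'\<bar> * \<delta> dA\<close>.  By injectivity \<open>\<integral> \<bar>R'\<bar>^2 dA\<close> is the area of the
  image and is at most \<open>\<pi>\<close>.  On the other hand \<open>\<integral> \<delta>^2 dA\<close> is at most a constant times \<open>n\<close>: on the ray of
  direction \<open>\<zeta>\<close>, \<open>\<delta>\<close> is at most \<open>1 / (1 - r)\<close> and at most four times the sum of the \<open>n\<close> Poisson kernels
  at \<open>\<zeta>\<close>, each of which has mean 1.  The Cauchy-Schwarz inequality gives \<open>ell R \<le> sqrt (32 * n)\<close>.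

  The lower bound comes from a star with \<open>N\<close> spikes of length comparable to 1 and width comparable to
  \<open>1 / N\<close>, which has area of order 1 and perimeter of order \<open>N\<close>.  A univalent map onto such a star is
  approximately \<open>z * (1 + \<epsilon> - z^N) powr (-1 / N)\<close> with \<open>\<epsilon>\<close> exponentially small in \<open>N\<close>: the \<open>N\<close>-th power of
  this map is the Moebius map \<open>w / (1 + \<epsilon> - w)\<close> of \<open>w = z^N\<close>.  The power \<open>x powr (-1 / N)\<close> is replaced by a
  rational function \<open>h x\<close> with alternating zeros and poles in geometric progression on the negative axis;
  since the scales run from \<open>\<epsilon>\<close> to a constant, a multiple of \<open>N\<close> factors suffices and the degree in \<open>z\<close> is of
  order \<open>N^2\<close>.  A telescoping sum shows that the logarithmic derivative of \<open>x * h x ^ N\<close> is small enough for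
  \<open>w * h (1 + \<epsilon> - w) ^ N\<close>, viewed as a function of \<open>1 / (1 + \<epsilon> - w)\<close>, to have a derivative with positive real
  part on a disc.  It is therefore injective, and so is \<open>z * h (1 + \<epsilon> - z^N)\<close>.
\<close>

section \<open>Averages over the unit circle\<close>

lemma Cauchy_formula_circle_average:
  fixes f :: "complex \<Rightarrow> complex"
  assumes "f holomorphic_on cball 0 1" "norm w < 1"
  shows "((\<lambda>t. f (cis t) * cis t / (cis t - w)) has_integral (2 * pi * f w)) {0..2*pi}"
proof -
  have "((\<lambda>u. f u / (u - w)) has_contour_integral (2 * of_real pi * \<i> * f w)) (part_circlepath 0 1 0 (2*pi))"
    using Cauchy_integral_circlepath_simple[of f 0 1 w] assms by (simp add: circlepath_def)
  then have "((\<lambda>t. f (cis t) / (cis t - w) * \<i> * cis t) has_integral (2 * of_real pi * \<i> * f w)) {0..2*pi}"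
    by (subst (asm) has_contour_integral_part_circlepath_iff) auto
  from has_integral_mult_right[OF this, of "-\<i>"] show ?thesis
    by (simp add: algebra_simps)
qed

lemma Cauchy_derivative_circle_average:
  fixes f :: "complex \<Rightarrow> complex"
  assumes "f holomorphic_on cball 0 1" "norm w < 1"
  shows "((\<lambda>t. f (cis t) * cis t / (cis t - w)\<^sup>2) has_integral (2 * pi * deriv f w)) {0..2*pi}"
proof -
  have hb: "f holomorphic_on ball 0 1" using assms(1) by (rule holomorphic_on_subset) auto
  have w: "w \<in> ball 0 1" using assms by simp
  note C = Cauchy_derivative_integral_circlepath[OF holomorphic_on_imp_continuous_on[OF assms(1)] hb w]
  have "contour_integral (circlepath 0 1) (\<lambda>u. f u / (u - w)\<^sup>2) = 2 * of_real pi * \<i> * deriv f w"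
    using DERIV_imp_deriv[OF C(2)] by simp
  with C(1) have "((\<lambda>u. f u / (u - w)\<^sup>2) has_contour_integral (2 * of_real pi * \<i> * deriv f w)) (part_circlepath 0 1 0 (2*pi))"
    by (metis circlepath_def has_contour_integral_integral)
  then have "((\<lambda>t. f (cis t) / (cis t - w)\<^sup>2 * \<i> * cis t) has_integral (2 * of_real pi * \<i> * deriv f w)) {0..2*pi}"
    by (subst (asm) has_contour_integral_part_circlepath_iff) auto
  from has_integral_mult_right[OF this, of "-\<i>"] show ?thesis
    by (simp add: algebra_simps)
qed

lemma cis_times_cnj_cis [simp]: "cis t * cnj (cis t) = 1" "cnj (cis t) * cis t = 1"
  by (simp_all add: cis_cnj cis_mult)

lemma cis_minus: "cis t - a = cis t * cnj (1 - cnj a * cis t)"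
proof -
  have "cis t * cnj (1 - cnj a * cis t) = cis t - a * (cis t * cnj (cis t))"
    by (simp only: complex_cnj_diff complex_cnj_mult complex_cnj_one complex_cnj_cnj right_diff_distrib mult_1_left mult_1_right mult_ac)
  then show ?thesis by simp
qed

lemma one_minus_cnj_mult_neq_0:
  fixes a z :: complex
  assumes "norm a < 1" "norm z \<le> 1"
  shows "1 - cnj a * z \<noteq> 0"
proof
  assume "1 - cnj a * z = 0"
  then have "norm (cnj a * z) = 1" by (metis eq_iff_diff_eq_0 norm_one)
  moreover have "norm a * norm z < 1"
    using assms by (metis le_less_trans mult_left_le norm_ge_zero)
  ultimately show False by (simp add: norm_mult)
qed

text \<open>On the circle \<open>\<bar>1 - cnj z * w\<bar>^2 = (w - z) * (1 - cnj z * w) / w\<close>, so this is Cauchy's formula for the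
  function \<open>w \<mapsto> f w / (1 - cnj z * w)\<close>.\<close>

lemma Poisson_formula_circle:
  fixes f :: "complex \<Rightarrow> complex"
  assumes "f holomorphic_on cball 0 1" "norm z < 1"
  shows "((\<lambda>t. f (cis t) / of_real ((cmod (1 - cnj z * cis t))\<^sup>2))
            has_integral (2 * pi * f z / (1 - (cmod z)\<^sup>2))) {0..2*pi}"
proof -
  have "((\<lambda>t. f (cis t) / (1 - cnj z * cis t) * cis t / (cis t - z)) has_integral
          (2 * pi * (f z / (1 - cnj z * z)))) {0..2*pi}"
    using one_minus_cnj_mult_neq_0 assms
    by (intro Cauchy_formula_circle_average holomorphic_intros) auto
  moreover have "f (cis t) / (1 - cnj z * cis t) * cis t / (cis t - z)
      = f (cis t) / of_real ((cmod (1 - cnj z * cis t))\<^sup>2)" for t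
  proof -
    have "cis t - z = cis t * cnj (1 - cnj z * cis t)" by (rule cis_minus)
    moreover have "of_real ((cmod (1 - cnj z * cis t))\<^sup>2) = (1 - cnj z * cis t) * cnj (1 - cnj z * cis t)"
      by (rule complex_norm_square)
    ultimately show ?thesis
      by (simp only:) (simp del: complex_cnj_diff)
  qed
  moreover have "cnj z * z = of_real ((cmod z)\<^sup>2)" by (metis complex_norm_square mult.commute)
  ultimately show ?thesis by simp
qed

section \<open>Blaschke products and their kernels\<close>

definition blaschke_factor :: "complex \<Rightarrow> complex \<Rightarrow> complex" where
  "blaschke_factor a z = (z - a) / (1 - cnj a * z)"

lemma one_minus_cnj_blaschke_factor:
  assumes "norm a < 1" "norm w \<le> 1" "norm z \<le> 1"
  shows "1 - cnj (blaschke_factor a w) * blaschke_factor a z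
     = (1 - (cmod a)\<^sup>2) * (1 - cnj w * z) / (cnj (1 - cnj a * w) * (1 - cnj a * z))"
proof -
  have "1 - cnj a * w \<noteq> 0" "1 - cnj a * z \<noteq> 0"
    using one_minus_cnj_mult_neq_0 assms by auto
  moreover from this(1) have "1 - a * cnj w \<noteq> 0"
    by (metis complex_cnj_cnj complex_cnj_diff complex_cnj_mult complex_cnj_one complex_cnj_zero)
  moreover have "of_real ((cmod a)\<^sup>2) = a * cnj a" by (rule complex_norm_square)
  ultimately show ?thesis
    by (simp add: blaschke_factor_def divide_simps) (simp add: algebra_simps)
qed

lemma norm_blaschke_factor_le_1:
  assumes "norm a < 1" "norm z \<le> 1"
  shows "norm (blaschke_factor a z) \<le> 1"
proof -
  have "of_real (1 - (cmod (blaschke_factor a z))\<^sup>2) = 1 - cnj (blaschke_factor a z) * blaschke_factor a z"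
    by (simp add: complex_norm_square mult.commute del: of_real_power)
  also have "\<dots> = of_real ((1 - (cmod a)\<^sup>2) * (1 - (cmod z)\<^sup>2) / (cmod (1 - cnj a * z))\<^sup>2)"
    using one_minus_cnj_blaschke_factor[OF assms(1) assms(2) assms(2)]
    by (simp add: complex_norm_square mult_ac del: of_real_power)
  finally have "1 - (cmod (blaschke_factor a z))\<^sup>2 = (1 - (cmod a)\<^sup>2) * (1 - (cmod z)\<^sup>2) / (cmod (1 - cnj a * z))\<^sup>2"
    using of_real_eq_iff by blast
  also have "\<dots> \<ge> 0" using assms by (simp add: abs_square_le_1)
  finally show ?thesis by (simp add: abs_square_le_1)
qed

lemma norm_blaschke_factor_cis: 
  assumes "norm a < 1"
  shows "norm (blaschke_factor a (cis t)) = 1"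
proof -
  have "cis t - a = cis t * cnj (1 - cnj a * cis t)" by (rule cis_minus)
  then have "norm (cis t - a) = norm (1 - cnj a * cis t)" by (metis complex_mod_cnj mult_1 norm_cis norm_mult)
  then show ?thesis using one_minus_cnj_mult_neq_0[of a "cis t"] assms
    by (simp add: blaschke_factor_def norm_divide)
qed

locale disc_points =
  fixes a :: "nat \<Rightarrow> complex"
  assumes norm_a: "norm (a k) < 1"
begin

definition blaschke_product :: "nat \<Rightarrow> complex \<Rightarrow> complex" where
  "blaschke_product n z = (\<Prod>k<n. blaschke_factor (a k) z)"

text \<open>The Takenaka-Malmquist functions: the first \<open>n\<close> of them form an orthonormal basis of the orthogonal
  complement of \<open>blaschke_product n\<close> times the Hardy space.\<close>

definition malmquist :: "nat \<Rightarrow> complex \<Rightarrow> complex" where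
  "malmquist k z = blaschke_product k z * of_real (sqrt (1 - (cmod (a k))\<^sup>2)) / (1 - cnj (a k) * z)"

text \<open>The reproducing kernel of that complement.  Defining it by the sum instead of the quotient in
  \<open>model_kernel_closed_form\<close> avoids the removable singularity at \<open>w = z\<close> on the circle, so that
  joint continuity on the closed disc is immediate.\<close>

definition model_kernel :: "nat \<Rightarrow> complex \<Rightarrow> complex \<Rightarrow> complex" where
  "model_kernel n w z = (\<Sum>k<n. cnj (malmquist k w) * malmquist k z)"

definition kernel_diag :: "nat \<Rightarrow> complex \<Rightarrow> real" where
  "kernel_diag n z = (\<Sum>k<n. (cmod (malmquist k z))\<^sup>2)"

lemma denominator_nonzero: "norm z \<le> 1 \<Longrightarrow> 1 - cnj (a k) * z \<noteq> 0"
  by (rule one_minus_cnj_mult_neq_0[OF norm_a])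

lemma power2_sqrt_one_minus: "(complex_of_real (sqrt (1 - (cmod (a k))\<^sup>2)))\<^sup>2 = of_real (1 - (cmod (a k))\<^sup>2)"
proof -
  have "(sqrt (1 - (cmod (a k))\<^sup>2))\<^sup>2 = 1 - (cmod (a k))\<^sup>2"
    using norm_a[of k] by (simp add: abs_square_le_1 less_imp_le)
  then show ?thesis by (metis of_real_power)
qed

lemma model_kernel_closed_form:
  assumes "norm w \<le> 1" "norm z \<le> 1"
  shows "(1 - cnj w * z) * model_kernel n w z = 1 - cnj (blaschke_product n w) * blaschke_product n z"
proof (induction n)
  case 0
  then show ?case by (simp add: model_kernel_def blaschke_product_def)
next
  case (Suc n)
  have "cnj (malmquist n w) * malmquist n z = cnj (blaschke_product n w) * blaschke_product n z * ((1 - (cmod (a n))\<^sup>2) / (cnj (1 - cnj (a n) * w) * (1 - cnj (a n) * z)))"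
    using power2_sqrt_one_minus[of n] by (simp add: malmquist_def power2_eq_square mult_ac)
  then have "(1 - cnj w * z) * (cnj (malmquist n w) * malmquist n z) = 
     cnj (blaschke_product n w) * blaschke_product n z * (1 - cnj (blaschke_factor (a n) w) * blaschke_factor (a n) z)"
    by (simp only: one_minus_cnj_blaschke_factor[OF norm_a assms]) (simp add: mult_ac)
  moreover have "blaschke_product (Suc n) v = blaschke_product n v * blaschke_factor (a n) v" for v by (simp add: blaschke_product_def)
  moreover have "model_kernel (Suc n) w z = model_kernel n w z + cnj (malmquist n w) * malmquist n z" by (simp add: model_kernel_def)
  ultimately show ?case using Suc.IH
    by (simp add: algebra_simps)
qed

lemma kernel_diag_eq: "of_real (kernel_diag n z) = model_kernel n z z"
  by (simp add: kernel_diag_def model_kernel_def complex_norm_square mult.commute del: of_real_power)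

lemma kernel_diag_closed_form:
  assumes "norm z \<le> 1"
  shows "(1 - (cmod z)\<^sup>2) * kernel_diag n z = 1 - (cmod (blaschke_product n z))\<^sup>2"
proof -
  have "complex_of_real ((1 - (cmod z)\<^sup>2) * kernel_diag n z) = (1 - cnj z * z) * model_kernel n z z"
    by (simp add: kernel_diag_eq complex_norm_square mult_ac del: of_real_power)
  also have "\<dots> = of_real (1 - (cmod (blaschke_product n z))\<^sup>2)"
    using model_kernel_closed_form[OF assms assms] by (simp add: complex_norm_square mult_ac del: of_real_power)
  finally show ?thesis using of_real_eq_iff by blast
qed

lemma norm_blaschke_product_le_1: "norm z \<le> 1 \<Longrightarrow> norm (blaschke_product n z) \<le> 1"
  unfolding blaschke_product_def by (simp add: prod_norm prod_le_1 norm_blaschke_factor_le_1 norm_a flip: prod_norm)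

lemma norm_blaschke_product_cis: "norm (blaschke_product n (cis t)) = 1"
  unfolding blaschke_product_def by (simp add: norm_blaschke_factor_cis norm_a flip: prod_norm)

lemma blaschke_product_holomorphic: "blaschke_product n holomorphic_on cball 0 1"
  unfolding blaschke_product_def[abs_def] blaschke_factor_def
  by (intro holomorphic_intros) (use denominator_nonzero in auto)

lemma malmquist_holomorphic: "malmquist n holomorphic_on cball 0 1"
  unfolding malmquist_def[abs_def]
  by (intro holomorphic_intros blaschke_product_holomorphic) (use denominator_nonzero in auto)

lemma kernel_diag_nonneg: "kernel_diag n z \<ge> 0" unfolding kernel_diag_def by (intro sum_nonneg) auto

text \<open>On the circle \<open>\<bar>1 - cnj (B w) * B z\<bar>^2 = 1 + \<bar>B z\<bar>^2 - 2 * Re (cnj (B z) * B w)\<close>, because \<open>\<bar>B w\<bar> = 1\<close>.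
  Thus the squared modulus of the kernel is the real part of a holomorphic function of \<open>w\<close> times
  the Poisson weight, and the Poisson formula evaluates its mean.\<close>

lemma model_kernel_norm_average:
  assumes z: "norm z < 1"
  shows "((\<lambda>t. (cmod (model_kernel n (cis t) z))\<^sup>2) has_integral (2 * pi * kernel_diag n z)) {0..2*pi}"
proof -
  have "((\<lambda>t. (1 + (cmod (blaschke_product n z))\<^sup>2 - 2 * cnj (blaschke_product n z) * blaschke_product n (cis t)) / of_real ((cmod (1 - cnj z * cis t))\<^sup>2))
            has_integral (2 * pi * (1 + (cmod (blaschke_product n z))\<^sup>2 - 2 * cnj (blaschke_product n z) * blaschke_product n z) / (1 - (cmod z)\<^sup>2))) {0..2*pi}"
    by (intro Poisson_formula_circle holomorphic_intros blaschke_product_holomorphic z)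
  from has_integral_linear[OF this bounded_linear_Re]
  have I: "((\<lambda>t. Re ((1 + (cmod (blaschke_product n z))\<^sup>2 - 2 * cnj (blaschke_product n z) * blaschke_product n (cis t)) / of_real ((cmod (1 - cnj z * cis t))\<^sup>2)))
     has_integral Re (2 * pi * (1 + (cmod (blaschke_product n z))\<^sup>2 - 2 * cnj (blaschke_product n z) * blaschke_product n z) / (1 - (cmod z)\<^sup>2))) {0..2*pi}"
    by (simp add: o_def)
  have 1: "Re ((1 + (cmod (blaschke_product n z))\<^sup>2 - 2 * cnj (blaschke_product n z) * blaschke_product n (cis t)) / of_real ((cmod (1 - cnj z * cis t))\<^sup>2))
      = (cmod (model_kernel n (cis t) z))\<^sup>2" for t
  proof -
    have nz: "1 - cnj z * cis t \<noteq> 0" using one_minus_cnj_mult_neq_0[of z "cis t"] z by simp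
    have "(cmod (1 - cnj (blaschke_product n (cis t)) * blaschke_product n z))\<^sup>2 = 1 + (cmod (blaschke_product n z))\<^sup>2 - 2 * Re (cnj (blaschke_product n z) * blaschke_product n (cis t))"
    proof -
      have "(cmod (1 - cnj (blaschke_product n (cis t)) * blaschke_product n z))\<^sup>2 = 1 + (cmod (cnj (blaschke_product n (cis t)) * blaschke_product n z))\<^sup>2 - 2 * Re (cnj (blaschke_product n (cis t)) * blaschke_product n z)"
        by (simp only: cmod_power2 minus_complex.sel one_complex.sel) (simp add: power2_eq_square algebra_simps)
      also have "cmod (cnj (blaschke_product n (cis t)) * blaschke_product n z) = cmod (blaschke_product n z)" by (simp add: norm_mult norm_blaschke_product_cis)
      also have "Re (cnj (blaschke_product n (cis t)) * blaschke_product n z) = Re (cnj (blaschke_product n z) * blaschke_product n (cis t))" by simp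
      finally show ?thesis .
    qed
    moreover have "cmod (1 - cnj (cis t) * z) = cmod (1 - cnj z * cis t)"
      by (metis complex_cnj_cnj complex_cnj_diff complex_cnj_mult complex_cnj_one complex_mod_cnj mult.commute)
    moreover have "(cmod (1 - cnj (cis t) * z))\<^sup>2 * (cmod (model_kernel n (cis t) z))\<^sup>2 = (cmod (1 - cnj (blaschke_product n (cis t)) * blaschke_product n z))\<^sup>2"
      using model_kernel_closed_form[of "cis t" z n] z by (simp flip: power_mult_distrib norm_mult)
    ultimately show ?thesis using nz
      by (simp add: field_simps Re_divide_of_real)
  qed
  have 2: "Re (2 * pi * (1 + (cmod (blaschke_product n z))\<^sup>2 - 2 * cnj (blaschke_product n z) * blaschke_product n z) / (1 - (cmod z)\<^sup>2)) = 2 * pi * kernel_diag n z"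
  proof -
    have "cnj (blaschke_product n z) * blaschke_product n z = of_real ((cmod (blaschke_product n z))\<^sup>2)" by (metis complex_norm_square mult.commute)
    then have "2 * pi * (1 + (cmod (blaschke_product n z))\<^sup>2 - 2 * cnj (blaschke_product n z) * blaschke_product n z) / (1 - (cmod z)\<^sup>2)
       = of_real (2 * pi * (1 - (cmod (blaschke_product n z))\<^sup>2) / (1 - (cmod z)\<^sup>2))"
      by (simp add: mult.assoc)
    moreover have "(1 - (cmod z)\<^sup>2) \<noteq> 0"
      using z by (metis abs_norm_cancel less_irrefl power2_eq_1_iff right_minus_eq abs_1 abs_minus_cancel norm_ge_zero neg_0_le_iff_le not_one_le_zero)
    moreover have "1 - (cmod (blaschke_product n z))\<^sup>2 = (1 - (cmod z)\<^sup>2) * kernel_diag n z" using kernel_diag_closed_form[of z n] z by simp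
    ultimately show ?thesis by (simp only: Re_complex_of_real) simp
  qed
  show ?thesis using I unfolding 1 2 .
qed

end

section \<open>The reproducing formula\<close>

definition polar :: "real \<times> real \<Rightarrow> complex" where
  "polar p = of_real (fst p) * cis (snd p)"

abbreviation polar_box :: "(real \<times> real) set" where
  "polar_box \<equiv> cbox (0, 0) (1, 2 * pi)"

lemma norm_polar_le_1: "p \<in> polar_box \<Longrightarrow> norm (polar p) \<le> 1"
  by (cases p) (auto simp: polar_def norm_mult)

lemma polar_in_cball: "p \<in> polar_box \<Longrightarrow> polar p \<in> cball 0 1"
  by (cases p) (auto simp: polar_def norm_mult)

lemma continuous_on_polar [continuous_intros]: "continuous_on S polar"
  unfolding polar_def[abs_def] by (intro continuous_intros)

lemma continuous_on_compose_polar: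
  assumes "continuous_on (cball 0 1) f"
  shows "continuous_on polar_box (\<lambda>p. f (polar p))"
  by (rule continuous_on_compose2[OF assms continuous_on_polar]) (use polar_in_cball in auto)

text \<open>Write \<open>v z = z * g z\<close> and \<open>\<Psi> r t = F z * cnj (v z)\<close> with \<open>z = r * cis t\<close>.  The polar form of
  Green's formula is the identity \<open>r * \<Psi>\<^sub>r = 2 * r^2 * F' z * cnj (g z) + \<i> * \<Psi>\<^sub>t\<close>: the last term
  integrates to 0 over a period, and integrating \<open>\<Psi>\<^sub>r\<close> over the radius first leaves the values
  of \<open>\<Psi>\<close> on the circle.\<close>

lemma polar_Green_formula:
  assumes U: "open U" "cball 0 1 \<subseteq> U" and F: "F holomorphic_on U" and g: "g holomorphic_on U"
  shows "integral polar_box (\<lambda>p. fst p * (deriv F (polar p) * cnj (g (polar p))))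
        = integral {0..2*pi} (\<lambda>t. F (cis t) * cnj (cis t * g (cis t))) / 2"
proof -
  define v where "v = (\<lambda>z. z * g z)"
  define z where "z = (\<lambda>r t. of_real r * cis t)"
  have v: "v holomorphic_on U" unfolding v_def by (intro holomorphic_intros g)
  have zU: "z r t \<in> cball 0 1" "z r t \<in> U" if "r \<in> {0..1}" for r t
    using that U by (auto simp: z_def norm_mult)
  have z_polar: "z r t = polar (r, t)" for r t by (simp add: z_def polar_def)
  \<comment> \<open>The radial and the angular derivative of \<open>F z * cnj (v z)\<close>.\<close>
  define Ar where "Ar = (\<lambda>r t. cis t * deriv F (z r t) * cnj (v (z r t)) + F (z r t) * cnj (cis t * deriv v (z r t)))"
  define At where "At = (\<lambda>r t. \<i> * z r t * deriv F (z r t) * cnj (v (z r t)) + F (z r t) * cnj (\<i> * z r t * deriv v (z r t)))"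
  have dF: "(F has_field_derivative deriv F x) (at x)" and dv: "(v has_field_derivative deriv v x) (at x)" if "x \<in> U" for x
    using F v U that by (auto intro: holomorphic_derivI)
  have dz1: "((\<lambda>r. z r t) has_vector_derivative cis t) (at r within S)" for r t S
    unfolding z_def by (auto intro!: derivative_eq_intros simp: has_vector_derivative_def scaleR_conv_of_real)
  have dz2: "((\<lambda>t. z r t) has_vector_derivative \<i> * z r t) (at t within S)" for r t S
    unfolding z_def cis_conv_exp
    by (rule derivative_eq_intros has_vector_derivative_real_field refl | simp)+
  have prodrule: "((\<lambda>s. F (\<gamma> s) * cnj (v (\<gamma> s))) has_vector_derivative
        (\<gamma>' * deriv F (\<gamma> x) * cnj (v (\<gamma> x)) + F (\<gamma> x) * cnj (\<gamma>' * deriv v (\<gamma> x)))) (at x within S)"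
    if "(\<gamma> has_vector_derivative \<gamma>') (at x within S)" "\<gamma> x \<in> U" for \<gamma> :: "real \<Rightarrow> complex" and \<gamma>' x S
  proof -
    have 1: "((\<lambda>s. F (\<gamma> s)) has_vector_derivative \<gamma>' * deriv F (\<gamma> x)) (at x within S)"
      using field_vector_diff_chain_within[OF that(1) has_field_derivative_at_within[OF dF[OF that(2)]]] by (simp add: o_def)
    have 2: "((\<lambda>s. v (\<gamma> s)) has_vector_derivative \<gamma>' * deriv v (\<gamma> x)) (at x within S)"
      using field_vector_diff_chain_within[OF that(1) has_field_derivative_at_within[OF dv[OF that(2)]]] by (simp add: o_def)
    from has_vector_derivative_cnj[OF 2]
    have 3: "((\<lambda>s. cnj (v (\<gamma> s))) has_vector_derivative cnj (\<gamma>' * deriv v (\<gamma> x))) (at x within S)" .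
    show ?thesis using has_vector_derivative_mult[OF 1 3] by (simp add: add.commute)
  qed
  have I1: "integral {0..1} (\<lambda>r. Ar r t) = F (cis t) * cnj (v (cis t))" for t
  proof -
    have "((\<lambda>r. Ar r t) has_integral (F (z 1 t) * cnj (v (z 1 t)) - F (z 0 t) * cnj (v (z 0 t)))) {0..1}"
      unfolding Ar_def
      by (intro fundamental_theorem_of_calculus prodrule dz1 zU) auto
    then show ?thesis by (simp add: integral_unique z_def v_def)
  qed
  have I2: "(At r has_integral 0) {0..2*pi}" if "r \<in> {0..1}" for r
  proof -
    have "(At r has_integral (F (z r (2*pi)) * cnj (v (z r (2*pi))) - F (z r 0) * cnj (v (z r 0)))) {0..2*pi}"
      unfolding At_def
      by (intro fundamental_theorem_of_calculus prodrule dz2 zU that) auto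
    then show ?thesis by (simp add: z_def)
  qed
  have pw: "of_real r * Ar r t = 2 * of_real r ^ 2 * (deriv F (z r t) * cnj (g (z r t))) + \<i> * At r t" for r t
  proof -
    have zc: "z r t * cnj (z r t) = of_real r ^ 2"
    proof -
      have "z r t * cnj (z r t) = of_real r ^ 2 * (cis t * cnj (cis t))"
        by (simp only: z_def complex_cnj_mult complex_cnj_complex_of_real power2_eq_square mult_ac)
      then show ?thesis by simp
    qed
    have "of_real r * Ar r t = z r t * deriv F (z r t) * cnj (v (z r t)) + F (z r t) * cnj (z r t * deriv v (z r t))"
      by (simp add: Ar_def z_def algebra_simps)
    also have "\<dots> = 2 * (z r t * cnj (z r t)) * (deriv F (z r t) * cnj (g (z r t))) + \<i> * At r t"
      by (simp add: At_def v_def algebra_simps)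
    finally show ?thesis by (simp add: zc)
  qed
  have cF: "continuous_on polar_box (\<lambda>p. F (polar p))" "continuous_on polar_box (\<lambda>p. deriv F (polar p))"
     "continuous_on polar_box (\<lambda>p. v (polar p))" "continuous_on polar_box (\<lambda>p. deriv v (polar p))"
     "continuous_on polar_box (\<lambda>p. g (polar p))"
    by (intro continuous_on_compose_polar holomorphic_on_imp_continuous_on holomorphic_on_subset[OF _ U(2)]
        F v g holomorphic_deriv U(1))+
  have cAr: "continuous_on polar_box (\<lambda>(r, t). Ar r t)"
    unfolding Ar_def z_polar case_prod_unfold prod.collapse by (intro continuous_intros cF)
  have cI: "continuous_on polar_box (\<lambda>p. complex_of_real (fst p) * (deriv F (polar p) * cnj (g (polar p))))"
    by (intro continuous_intros cF)
  have cslice: "continuous_on {0..2*pi} (\<lambda>t. deriv F (z r t) * cnj (g (z r t)))" if "r \<in> {0..1}" for r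
  proof -
    have "continuous_on polar_box (\<lambda>p. deriv F (polar p) * cnj (g (polar p)))"
      by (intro continuous_intros cF)
    then show ?thesis unfolding z_polar
      by (rule continuous_on_compose2) (use that in \<open>auto intro!: continuous_intros\<close>)
  qed
  have inner: "integral {0..2*pi} (\<lambda>t. of_real r * (deriv F (z r t) * cnj (g (z r t)))) = integral {0..2*pi} (Ar r) / 2"
    if r: "r \<in> {0..1} - {0}" for r
  proof -
    have "((\<lambda>t. deriv F (z r t) * cnj (g (z r t))) has_integral integral {0..2*pi} (\<lambda>t. deriv F (z r t) * cnj (g (z r t)))) {0..2*pi}" (is "(_ has_integral ?J) _")
      using r by (intro integrable_integral integrable_continuous_interval cslice) auto
    then have "((\<lambda>t. 2 * of_real r ^ 2 * (deriv F (z r t) * cnj (g (z r t))) + \<i> * At r t) has_integral 2 * of_real r ^ 2 * ?J + \<i> * 0) {0..2*pi}"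
      using r by (intro has_integral_add has_integral_mult_right I2) auto
    then have "((\<lambda>t. of_real r * Ar r t) has_integral 2 * of_real r ^ 2 * ?J) {0..2*pi}"
      by (simp add: pw)
    from has_integral_mult_right[OF this, of "1 / of_real r"] r
    have "(Ar r has_integral 2 * of_real r * ?J) {0..2*pi}" by (simp add: power2_eq_square mult.assoc)
    then show ?thesis by (simp add: integral_unique)
  qed
  have "integral polar_box (\<lambda>p. fst p * (deriv F (polar p) * cnj (g (polar p))))
     = integral {0..1} (\<lambda>r. integral {0..2*pi} (\<lambda>t. of_real r * (deriv F (z r t) * cnj (g (z r t)))))"
    using integral_prod_continuous[OF cI] by (simp add: z_polar cbox_interval)
  also have "\<dots> = integral {0..1} (\<lambda>r. integral {0..2*pi} (Ar r) / 2)"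
    \<comment> \<open>The division by \<open>r\<close> in the inner identity excludes \<open>r = 0\<close>, a null set.\<close>
    by (rule integral_spike[of "{0}"]) (use inner in auto)
  also have "\<dots> = integral {0..1} (\<lambda>r. integral {0..2*pi} (Ar r)) / 2" by simp
  also have "integral {0..1} (\<lambda>r. integral {0..2*pi} (Ar r)) = integral {0..2*pi} (\<lambda>t. integral {0..1} (\<lambda>r. Ar r t))"
    using integral_swap_continuous[OF cAr] by (simp add: cbox_interval)
  finally show ?thesis by (simp add: I1 v_def)
qed

context disc_points
begin

text \<open>The functions above are holomorphic beyond the closed disc; Green's formula needs an open domain
  that contains it.\<close>

definition pole_free :: "nat \<Rightarrow> complex set" where "pole_free n = (\<Inter>k<n. {z. 1 - cnj (a k) * z \<noteq> 0})"

lemma open_pole_free: "open (pole_free n)"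
  unfolding pole_free_def by (intro open_INT ballI open_Collect_neq continuous_intros) auto

lemma cball_subset_pole_free: "cball 0 1 \<subseteq> pole_free n"
  unfolding pole_free_def using denominator_nonzero by auto

lemma malmquist_holomorphic_pole_free: "k < n \<Longrightarrow> malmquist k holomorphic_on pole_free n"
  unfolding malmquist_def[abs_def] blaschke_product_def blaschke_factor_def
  by (intro holomorphic_intros) (auto simp: pole_free_def)

lemma model_kernel_holomorphic: "model_kernel n w holomorphic_on pole_free n"
  unfolding model_kernel_def[abs_def] by (intro holomorphic_intros malmquist_holomorphic_pole_free) auto

lemma continuous_on_model_kernel:
  assumes "continuous_on S f" "continuous_on S g" "\<And>x. x \<in> S \<Longrightarrow> norm (f x) \<le> 1" "\<And>x. x \<in> S \<Longrightarrow> norm (g x) \<le> 1"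
  shows "continuous_on S (\<lambda>x. model_kernel n (f x) (g x))"
proof -
  have "continuous_on (cball 0 1) (malmquist k)" for k
    by (rule holomorphic_on_imp_continuous_on[OF malmquist_holomorphic])
  moreover have "f ` S \<subseteq> cball 0 1" "g ` S \<subseteq> cball 0 1" using assms(3,4) by auto
  ultimately have "continuous_on S (\<lambda>x. malmquist k (f x))" "continuous_on S (\<lambda>x. malmquist k (g x))" for k
    using continuous_on_compose2 assms(1,2) by blast+
  then show ?thesis unfolding model_kernel_def by (intro continuous_intros)
qed

text \<open>By Green's formula the area integral is \<open>\<pi>\<close> times the mean of \<open>R \<zeta> * cnj (\<zeta> * (k \<zeta>)^2)\<close> over the circle, where
  \<open>k = model_kernel n w\<close>.
  Expanding \<open>cnj (1 - cnj (B w) * B)^2\<close>, the term 1 yields Cauchy's formula for \<open>R' w\<close>.  The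
  other terms contain the factor \<open>R * cnj B\<close>, whose conjugate extends to the function \<open>T\<close>, so
  the conjugate of their sum extends to a holomorphic function \<open>E\<close> with \<open>E 0 = 0\<close> and has mean 0.\<close>

lemma reproducing_formula:
  fixes w :: complex
  assumes U: "open U" "cball 0 1 \<subseteq> U" and R: "R holomorphic_on U"
    and T: "T holomorphic_on cball 0 1" and TR: "\<And>t. cnj (R (cis t)) * blaschke_product n (cis t) = T (cis t)"
    and w: "norm w < 1"
  shows "integral polar_box (\<lambda>p. fst p * (deriv R (polar p) * cnj ((model_kernel n w (polar p))\<^sup>2))) = pi * deriv R w"
proof -
  let ?b = "blaschke_product n w"
  define E where "E = (\<lambda>z. T z * (2 * cnj ?b - (cnj ?b)\<^sup>2 * blaschke_product n z) * z / (1 - cnj w * z)\<^sup>2)"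
  have "E holomorphic_on cball 0 1"
    unfolding E_def by (intro holomorphic_intros T blaschke_product_holomorphic) (use one_minus_cnj_mult_neq_0 w in auto)
  from Cauchy_formula_circle_average[OF this, of 0]
  have "((\<lambda>t. E (cis t)) has_integral 0) {0..2*pi}" by (simp add: E_def)
  from has_integral_linear[OF this bounded_linear_cnj]
  have E0: "((\<lambda>t. cnj (E (cis t))) has_integral 0) {0..2*pi}" by (simp add: o_def)
  have C: "((\<lambda>t. R (cis t) * cis t / (cis t - w)\<^sup>2) has_integral (2 * pi * deriv R w)) {0..2*pi}"
    by (rule Cauchy_derivative_circle_average[OF holomorphic_on_subset[OF R U(2)] w])
  have pw: "R (cis t) * cnj (cis t * (model_kernel n w (cis t))\<^sup>2) = R (cis t) * cis t / (cis t - w)\<^sup>2 - cnj (E (cis t))" for t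
  proof -
    let ?z = "cis t"
    have nz: "1 - w * cnj ?z \<noteq> 0"
      using one_minus_cnj_mult_neq_0[of w ?z] w
      by (metis complex_cnj_cnj complex_cnj_diff complex_cnj_mult complex_cnj_one complex_cnj_zero norm_cis order_refl)
    have Kz: "cnj (model_kernel n w ?z) = (1 - ?b * cnj (blaschke_product n ?z)) / (1 - w * cnj ?z)"
    proof -
      have "cnj ((1 - cnj w * ?z) * model_kernel n w ?z) = cnj (1 - cnj ?b * blaschke_product n ?z)"
        using model_kernel_closed_form[of w ?z n] w by simp
      then have "(1 - w * cnj ?z) * cnj (model_kernel n w ?z) = 1 - ?b * cnj (blaschke_product n ?z)"
        by (simp only: complex_cnj_mult complex_cnj_diff complex_cnj_one complex_cnj_cnj)
      then show ?thesis using nz by (simp add: field_simps)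
    qed
    have "?z - w = ?z * (1 - w * cnj ?z)" by (simp add: algebra_simps flip: mult.assoc)
    then have "?z / (?z - w)\<^sup>2 = cnj ?z / (1 - w * cnj ?z)\<^sup>2"
      using nz by (simp add: power_mult_distrib power2_eq_square divide_simps) 
    then have 1: "R ?z * ?z / (?z - w)\<^sup>2 = R ?z * cnj ?z / (1 - w * cnj ?z)\<^sup>2"
      by (simp flip: times_divide_eq_right)
    have "cnj (T ?z) = R ?z * cnj (blaschke_product n ?z)" by (simp flip: TR)
    then have 2: "cnj (E ?z) = R ?z * cnj (blaschke_product n ?z) * (2 * ?b - ?b\<^sup>2 * cnj (blaschke_product n ?z)) * cnj ?z / (1 - w * cnj ?z)\<^sup>2"
      unfolding E_def
      by (simp only: complex_cnj_mult complex_cnj_diff complex_cnj_one complex_cnj_cnj complex_cnj_divide complex_cnj_power complex_cnj_numeral)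
    have "R ?z * cnj (?z * (model_kernel n w ?z)\<^sup>2) = R ?z * cnj ?z * (1 - ?b * cnj (blaschke_product n ?z))\<^sup>2 / (1 - w * cnj ?z)\<^sup>2"
      by (simp only: complex_cnj_mult complex_cnj_power Kz power_divide times_divide_eq_right mult_ac)
    also have "\<dots> = R ?z * cnj ?z / (1 - w * cnj ?z)\<^sup>2 - cnj (E ?z)"
      unfolding 2 by (simp add: power2_eq_square algebra_simps flip: diff_divide_distrib)
    finally show ?thesis by (simp add: 1)
  qed
  have "((\<lambda>t. R (cis t) * cnj (cis t * (model_kernel n w (cis t))\<^sup>2)) has_integral (2 * pi * deriv R w - 0)) {0..2*pi}"
    unfolding pw by (intro has_integral_diff C E0)
  then have "integral {0..2*pi} (\<lambda>t. R (cis t) * cnj (cis t * (model_kernel n w (cis t))\<^sup>2)) = 2 * pi * deriv R w"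
    by (simp add: integral_unique)
  moreover have "integral polar_box (\<lambda>p. fst p * (deriv R (polar p) * cnj ((model_kernel n w (polar p))\<^sup>2)))
      = integral {0..2*pi} (\<lambda>t. R (cis t) * cnj (cis t * (model_kernel n w (cis t))\<^sup>2)) / 2"
    using U cball_subset_pole_free
    by (intro polar_Green_formula[of "U \<inter> pole_free n"] open_Int open_pole_free holomorphic_intros
          holomorphic_on_subset[OF R] holomorphic_on_subset[OF model_kernel_holomorphic]) auto
  ultimately show ?thesis by simp
qed

section \<open>The length is controlled by the area\<close>

lemma continuous_on_kernel_diag: "continuous_on (cball 0 1) (kernel_diag n)"
  unfolding kernel_diag_def[abs_def]
  by (intro continuous_intros holomorphic_on_imp_continuous_on malmquist_holomorphic)

lemma continuous_on_kernel_diag_polar: "continuous_on polar_box (\<lambda>p. kernel_diag n (polar p))"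
  by (rule continuous_on_compose_polar[OF continuous_on_kernel_diag])

text \<open>Both sides are continuous in \<open>z\<close>, so the identity extends to the boundary.\<close>

lemma model_kernel_norm_average_cball:
  assumes z: "norm z \<le> 1"
  shows "integral {0..2*pi} (\<lambda>t. (cmod (model_kernel n (cis t) z))\<^sup>2) = 2 * pi * kernel_diag n z"
proof -
  let ?f = "\<lambda>z. integral (cbox 0 (2*pi)) (\<lambda>t. (cmod (model_kernel n (cis t) z))\<^sup>2) - 2 * pi * kernel_diag n z"
  have cK: "continuous_on (cball 0 1 \<times> cbox 0 (2*pi)) (\<lambda>p. model_kernel n (cis (snd p)) (fst p))"
    by (intro continuous_on_model_kernel continuous_intros) auto
  have "continuous_on (cball 0 1) ?f"
    by (intro continuous_intros continuous_on_kernel_diag integral_continuous_on_param)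
       (use cK in \<open>auto intro!: continuous_intros simp: case_prod_unfold\<close>)
  then have "continuous_on (closure (ball 0 1)) ?f" by simp
  then have "?f z = 0"
    by (rule continuous_constant_on_closure)
       (use z model_kernel_norm_average in \<open>auto simp: integral_unique cbox_interval\<close>)
  then show ?thesis by (simp add: cbox_interval)
qed

text \<open>Blaschke products are bounded by 1, which leaves the functions
  \<open>(1 - \<bar>a k\<bar>^2) / \<bar>1 - cnj (a k) * z\<bar>^2\<close>.  Moving \<open>z\<close> radially to the circle changes the denominator at
  most by a factor 4, since the displacement \<open>1 - r\<close> is at most \<open>\<bar>1 - cnj (a k) * z\<bar>\<close>.\<close>

lemma kernel_diag_le_Poisson_sum:
  assumes "r \<in> {0..1}"
  shows "kernel_diag n (polar (r, s)) \<le> 4 * (\<Sum>k<n. (1 - (cmod (a k))\<^sup>2) / (cmod (1 - cnj (a k) * cis s))\<^sup>2)"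
  unfolding kernel_diag_def sum_distrib_left
proof (rule sum_mono)
  fix k
  define z where "z = polar (r, s)"
  have nz: "norm z \<le> 1" using polar_in_cball[of "(r, s)"] assms unfolding z_def polar_def by (simp add: norm_mult)
  define x where "x = cmod (1 - cnj (a k) * cis s)"
  define y where "y = cmod (1 - cnj (a k) * z)"
  have pos: "x > 0" "y > 0" using denominator_nonzero nz unfolding x_def y_def by auto
  have nk: "(cmod (a k))\<^sup>2 \<le> 1" using norm_a[of k] by (simp add: abs_square_le_1 less_imp_le)
  have "1 - r \<le> y"
  proof -
    have "cmod (cnj (a k) * z) \<le> 1 * r"
      unfolding norm_mult z_def polar_def
      using norm_a[of k] assms by (intro mult_mono) (auto simp: norm_mult)
    then show ?thesis unfolding y_def using norm_triangle_ineq2[of 1 "cnj (a k) * z"] by simp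
  qed
  moreover have "x \<le> y + (1 - r)"
  proof -
    have "1 - cnj (a k) * cis s = (1 - cnj (a k) * z) - cnj (a k) * cis s * of_real (1 - r)"
      by (simp add: z_def polar_def algebra_simps)
    then have "x \<le> y + cmod (cnj (a k) * cis s * of_real (1 - r))"
      unfolding x_def y_def by (metis norm_triangle_ineq4)
    also have "cmod (cnj (a k) * cis s * of_real (1 - r)) = cmod (a k) * (1 - r)"
      using assms by (simp only: norm_mult norm_of_real norm_cis complex_mod_cnj) simp
    also have "\<dots> \<le> 1 * (1 - r)" using norm_a[of k] assms by (intro mult_right_mono) auto
    finally show ?thesis by simp
  qed
  ultimately have "x \<le> 2 * y" by simp
  then have xy: "x\<^sup>2 \<le> 4 * y\<^sup>2" using pos power_mono[of x "2*y" 2] by (simp add: power_mult_distrib)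
  have "(cmod (malmquist k z))\<^sup>2 = (cmod (blaschke_product k z))\<^sup>2 * (1 - (cmod (a k))\<^sup>2) / y\<^sup>2"
    using nk by (simp add: malmquist_def norm_mult norm_divide power_mult_distrib power_divide y_def)
  also have "\<dots> \<le> 1 * (1 - (cmod (a k))\<^sup>2) / y\<^sup>2"
    using nk norm_blaschke_product_le_1[OF nz, of k]
    by (intro divide_right_mono mult_right_mono) (auto simp: abs_square_le_1)
  also have "\<dots> \<le> 4 * ((1 - (cmod (a k))\<^sup>2) / x\<^sup>2)"
  proof -
    have "1 / y\<^sup>2 \<le> 4 / x\<^sup>2" using pos xy by (simp add: field_simps)
    from mult_left_mono[OF this, of "1 - (cmod (a k))\<^sup>2"] nk show ?thesis by (simp add: mult.commute)
  qed
  finally show "(cmod (malmquist k (polar (r, s))))\<^sup>2 \<le> 4 * ((1 - (cmod (a k))\<^sup>2) / (cmod (1 - cnj (a k) * cis s))\<^sup>2)"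
    by (simp add: x_def z_def)
qed

lemma kernel_diag_le_inverse:
  assumes "r \<in> {0..1}"
  shows "(1 - r) * kernel_diag n (polar (r, s)) \<le> 1"
proof -
  let ?z = "polar (r, s)"
  have nz: "norm ?z = r" using assms unfolding polar_def by (simp add: norm_mult)
  have "(1 - r) * kernel_diag n ?z \<le> (1 - r\<^sup>2) * kernel_diag n ?z"
    using assms power_decreasing[of 1 2 r] by (intro mult_right_mono kernel_diag_nonneg) auto
  also have "\<dots> \<le> 1" using kernel_diag_closed_form[of ?z n] nz assms by simp
  finally show ?thesis .
qed

text \<open>With \<open>M s\<close> denoting the bound of \<open>kernel_diag_le_Poisson_sum\<close>, the two bounds on the diagonal kernel
  combine to \<open>2 * M s / (1 + M s * (1 - r))\<close>, whose square has the integral \<open>4 * M s\<close> at most over the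
  radius.  The mean of \<open>M\<close> is \<open>4 * n\<close>, because each Poisson kernel has mean 1.\<close>

lemma integral_kernel_diag_square_le:
  "integral polar_box (\<lambda>p. fst p * (kernel_diag n (polar p))\<^sup>2) \<le> 32 * pi * n"
proof -
  define M where "M = (\<lambda>s. 4 * (\<Sum>k<n. (1 - (cmod (a k))\<^sup>2) / (cmod (1 - cnj (a k) * cis s))\<^sup>2))"
  have M0: "M s \<ge> 0" for s
    unfolding M_def using norm_a
    by (intro mult_nonneg_nonneg sum_nonneg divide_nonneg_nonneg) (auto simp: abs_square_le_1 less_imp_le)
  have M_int: "(M has_integral 8 * pi * n) {0..2*pi}"
  proof -
    have "((\<lambda>t. (1 - (cmod (a k))\<^sup>2) / (cmod (1 - cnj (a k) * cis t))\<^sup>2) has_integral 2 * pi) {0..2*pi}" for k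
    proof -
      define c where "c = 1 - (cmod (a k))\<^sup>2"
      have "((\<lambda>t. of_real c / of_real ((cmod (1 - cnj (a k) * cis t))\<^sup>2))
            has_integral (complex_of_real (2 * pi) * complex_of_real c / complex_of_real (1 - (cmod (a k))\<^sup>2))) {0..2*pi}"
        by (intro Poisson_formula_circle norm_a holomorphic_intros)
      moreover have "c \<noteq> 0" unfolding c_def
        using norm_a[of k] by (metis abs_norm_cancel less_irrefl power2_eq_1_iff right_minus_eq abs_1 abs_minus_cancel norm_ge_zero neg_0_le_iff_le not_one_le_zero)
      then have "complex_of_real (2 * pi) * complex_of_real c / complex_of_real (1 - (cmod (a k))\<^sup>2) = complex_of_real (2 * pi)"
        unfolding c_def by (metis nonzero_mult_div_cancel_right of_real_eq_0_iff)
      ultimately have "((\<lambda>t. complex_of_real ((1 - (cmod (a k))\<^sup>2) / (cmod (1 - cnj (a k) * cis t))\<^sup>2))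
            has_integral complex_of_real (2 * pi)) {0..2*pi}"
        by (simp only: of_real_divide c_def)
      from has_integral_linear[OF this bounded_linear_Re] show ?thesis by (simp add: o_def)
    qed
    then have "(M has_integral 4 * (\<Sum>k<n. 2 * pi)) {0..2*pi}"
      unfolding M_def by (intro has_integral_mult_right has_integral_sum) auto
    then show ?thesis by (simp add: mult_ac)
  qed
  have cI: "continuous_on polar_box (\<lambda>p. fst p * (kernel_diag n (polar p))\<^sup>2)"
    by (intro continuous_intros continuous_on_kernel_diag_polar)
  then have cI': "continuous_on (cbox (0,0) (1, 2*pi)) (\<lambda>(r, s). r * (kernel_diag n (polar (r, s)))\<^sup>2)"
    by (simp add: case_prod_unfold)
  have inner: "integral {0..1} (\<lambda>r. r * (kernel_diag n (polar (r, s)))\<^sup>2) \<le> 4 * M s" if s: "s \<in> {0..2*pi}" for s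
  proof -
    let ?G = "\<lambda>r. 4 * M s / (1 + M s * (1 - r))"
    have pos: "1 + M s * (1 - r) > 0" if "r \<in> {0..1}" for r
      using that M0[of s] by (auto intro!: add_pos_nonneg mult_nonneg_nonneg)
    have G: "((\<lambda>r. (2 * M s / (1 + M s * (1 - r)))\<^sup>2) has_integral (?G 1 - ?G 0)) {0..1}"
    proof (rule fundamental_theorem_of_calculus)
      fix r :: real assume r: "r \<in> {0..1}"
      have "(?G has_real_derivative (2 * M s / (1 + M s * (1 - r)))\<^sup>2) (at r within {0..1})"
        using pos[OF r]
        by (auto intro!: derivative_eq_intros simp: power2_eq_square)
      then show "(?G has_vector_derivative (2 * M s / (1 + M s * (1 - r)))\<^sup>2) (at r within {0..1})"
        by (simp add: has_real_derivative_iff_has_vector_derivative)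
    qed simp
    have "continuous_on {0..1} (\<lambda>r. r * (kernel_diag n (polar (r, s)))\<^sup>2)"
      using continuous_on_compose2[OF cI, of "{0..1}" "\<lambda>r. (r, s)"] s
      by (simp add: continuous_on_Pair image_subset_iff)
    then have "integral {0..1} (\<lambda>r. r * (kernel_diag n (polar (r, s)))\<^sup>2) \<le> ?G 1 - ?G 0"
    proof (intro has_integral_le[OF integrable_integral[OF integrable_continuous_interval] G])
      fix r :: real assume r: "r \<in> {0..1}"
      have "kernel_diag n (polar (r, s)) * (1 + M s * (1 - r)) = kernel_diag n (polar (r, s)) + M s * ((1 - r) * kernel_diag n (polar (r, s)))"
        by (simp add: algebra_simps)
      also have "\<dots> \<le> M s + M s * 1"
        using kernel_diag_le_Poisson_sum[OF r, of n s] kernel_diag_le_inverse[OF r, of n s] M0[of s]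
        by (intro add_mono mult_left_mono) (auto simp: M_def)
      finally have "kernel_diag n (polar (r, s)) \<le> 2 * M s / (1 + M s * (1 - r))"
        using pos[OF r] by (simp add: field_simps)
      then have "(kernel_diag n (polar (r, s)))\<^sup>2 \<le> (2 * M s / (1 + M s * (1 - r)))\<^sup>2"
        by (intro power_mono kernel_diag_nonneg)
      then show "r * (kernel_diag n (polar (r, s)))\<^sup>2 \<le> (2 * M s / (1 + M s * (1 - r)))\<^sup>2"
        using r mult_right_mono[of r 1 "(kernel_diag n (polar (r, s)))\<^sup>2"] by auto
    qed auto
    also have "\<dots> \<le> 4 * M s" using M0[of s] by simp
    finally show ?thesis .
  qed
  have "integral polar_box (\<lambda>p. fst p * (kernel_diag n (polar p))\<^sup>2) 
      = integral (cbox 0 1) (\<lambda>r. integral (cbox 0 (2*pi)) (\<lambda>s. r * (kernel_diag n (polar (r, s)))\<^sup>2))"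
    using integral_prod_continuous[OF cI] by simp
  also have "\<dots> = integral {0..2*pi} (\<lambda>s. integral {0..1} (\<lambda>r. r * (kernel_diag n (polar (r, s)))\<^sup>2))"
    using integral_swap_continuous[OF cI'] by (simp add: cbox_interval)
  also have "\<dots> \<le> 4 * (8 * pi * n)"
  proof (rule has_integral_le[OF integrable_integral has_integral_mult_right[OF M_int]])
    have "continuous_on (cbox 0 (2*pi)) (\<lambda>s. integral (cbox 0 1) (\<lambda>r. r * (kernel_diag n (polar (r, s)))\<^sup>2))"
      by (intro integral_continuous_on_param)
         (use continuous_on_compose2[OF cI, of "cbox 0 (2*pi) \<times> cbox 0 1" "\<lambda>p. (snd p, fst p)"] in
           \<open>simp add: case_prod_unfold continuous_on_Pair continuous_on_fst continuous_on_snd continuous_on_id image_subset_iff\<close>)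
    then show "(\<lambda>s. integral {0..1} (\<lambda>r. r * (kernel_diag n (polar (r, s)))\<^sup>2)) integrable_on {0..2*pi}"
      by (simp add: cbox_interval integrable_continuous_interval)
  qed (use inner in auto)
  finally show ?thesis by simp
qed

text \<open>The reproducing formula concerns points \<open>w\<close> inside the disc; continuity of both sides in \<open>w\<close> carries the
  resulting estimate to the circle.\<close>

lemma norm_deriv_le:
  assumes U: "open U" "cball 0 1 \<subseteq> U" and R: "R holomorphic_on U"
    and T: "T holomorphic_on cball 0 1" and TR: "\<And>t. cnj (R (cis t)) * blaschke_product n (cis t) = T (cis t)"
    and w: "norm w \<le> 1"
  shows "pi * cmod (deriv R w) \<le> integral polar_box (\<lambda>p. fst p * cmod (deriv R (polar p)) * (cmod (model_kernel n w (polar p)))\<^sup>2)"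
proof -
  have cR: "continuous_on (cball 0 1) (deriv R)"
    by (intro holomorphic_on_imp_continuous_on holomorphic_on_subset[OF _ U(2)] holomorphic_deriv R U(1))
  note cRp = continuous_on_compose_polar[OF cR]
  define F where "F = (\<lambda>w p. fst p * cmod (deriv R (polar p)) * (cmod (model_kernel n w (polar p)))\<^sup>2)"
  let ?h = "\<lambda>w. pi * cmod (deriv R w) - integral polar_box (F w)"
  have cK: "continuous_on (cball 0 1 \<times> polar_box) (\<lambda>q. model_kernel n (fst q) (polar (snd q)))"
    by (intro continuous_on_model_kernel continuous_intros continuous_on_compose2[OF continuous_on_polar[of UNIV]]) (auto simp: norm_polar_le_1)
  have cF: "continuous_on (cball 0 1 \<times> polar_box) (\<lambda>(w, p). F w p)"
    unfolding F_def case_prod_unfold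
    by (intro continuous_intros cK continuous_on_compose2[OF cRp]) auto
  have "continuous_on (cball 0 1) ?h"
    by (intro continuous_intros cR integral_continuous_on_param cF)
  then have "continuous_on (closure (ball 0 1)) ?h" by simp
  then have "?h w \<le> 0"
  proof (rule continuous_le_on_closure)
    fix w :: complex assume "w \<in> ball 0 1"
    then have w: "norm w < 1" by simp
    have cKp: "continuous_on polar_box (\<lambda>p. model_kernel n w (polar p))"
      by (intro continuous_on_model_kernel continuous_intros) (use w norm_polar_le_1 in auto)
    have "cmod (integral polar_box (\<lambda>p. fst p * (deriv R (polar p) * cnj ((model_kernel n w (polar p))\<^sup>2)))) \<le> integral polar_box (F w)"
    proof (rule integral_norm_bound_integral)
      show "(\<lambda>p. fst p * (deriv R (polar p) * cnj ((model_kernel n w (polar p))\<^sup>2))) integrable_on polar_box"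
        by (intro integrable_continuous continuous_intros cRp cKp)
      show "F w integrable_on polar_box" unfolding F_def
        by (intro integrable_continuous continuous_intros cRp cKp)
    next
      fix p assume "p \<in> polar_box"
      then have "fst p \<ge> 0" by (cases p) auto
      then show "cmod (complex_of_real (fst p) * (deriv R (polar p) * cnj ((model_kernel n w (polar p))\<^sup>2))) \<le> F w p"
        by (simp add: F_def norm_mult norm_power)
    qed
    then show "?h w \<le> 0"
      unfolding reproducing_formula[OF U R T TR w] by (simp add: norm_mult)
  qed (use w in auto)
  then show ?thesis by (simp add: F_def)
qed

lemma integral_norm_deriv_le:
  assumes U: "open U" "cball 0 1 \<subseteq> U" and R: "R holomorphic_on U"
    and T: "T holomorphic_on cball 0 1" and TR: "\<And>t. cnj (R (cis t)) * blaschke_product n (cis t) = T (cis t)"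
  shows "integral {0..2*pi} (\<lambda>t. cmod (deriv R (cis t)))
     \<le> 2 * integral polar_box (\<lambda>p. fst p * cmod (deriv R (polar p)) * kernel_diag n (polar p))"
proof -
  have cR: "continuous_on (cball 0 1) (deriv R)"
    by (intro holomorphic_on_imp_continuous_on holomorphic_on_subset[OF _ U(2)] holomorphic_deriv R U(1))
  note cRp = continuous_on_compose_polar[OF cR]
  define F where "F = (\<lambda>t p. fst p * cmod (deriv R (polar p)) * (cmod (model_kernel n (cis t) (polar p)))\<^sup>2)"
  have cK: "continuous_on (cbox 0 (2*pi) \<times> polar_box) (\<lambda>q. model_kernel n (cis (fst q)) (polar (snd q)))"
    by (intro continuous_on_model_kernel continuous_intros continuous_on_compose2[OF continuous_on_polar[of UNIV]]) (auto simp: norm_polar_le_1)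
  have cF: "continuous_on (cbox 0 (2*pi) \<times> polar_box) (\<lambda>(t, p). F t p)"
    unfolding F_def case_prod_unfold
    by (intro continuous_intros cK continuous_on_compose2[OF cRp]) auto
  have "pi * integral {0..2*pi} (\<lambda>t. cmod (deriv R (cis t))) = integral (cbox 0 (2*pi)) (\<lambda>t. pi * cmod (deriv R (cis t)))"
    by (simp add: cbox_interval)
  also have "\<dots> \<le> integral (cbox 0 (2*pi)) (\<lambda>t. integral polar_box (F t))"
  proof (rule integral_le)
    show "(\<lambda>t. pi * cmod (deriv R (cis t))) integrable_on cbox 0 (2*pi)"
      by (intro integrable_continuous continuous_intros continuous_on_compose2[OF cR]) auto
    show "(\<lambda>t. integral polar_box (F t)) integrable_on cbox 0 (2*pi)"
      by (intro integrable_continuous integral_continuous_on_param cF)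
  qed (use norm_deriv_le[OF U R T TR] in \<open>auto simp: F_def\<close>)
  also have "\<dots> = integral polar_box (\<lambda>p. integral (cbox 0 (2*pi)) (\<lambda>t. F t p))"
    by (rule integral_swap_continuous) (use cF in \<open>simp add: cbox_Pair_eq\<close>)
  also have "\<dots> = integral polar_box (\<lambda>p. 2 * pi * (fst p * cmod (deriv R (polar p)) * kernel_diag n (polar p)))"
  proof (rule integral_cong)
    fix p assume "p \<in> polar_box"
    then have "norm (polar p) \<le> 1" using polar_in_cball by auto
    from model_kernel_norm_average_cball[OF this, of n]
    show "integral (cbox 0 (2*pi)) (\<lambda>t. F t p) = 2 * pi * (fst p * cmod (deriv R (polar p)) * kernel_diag n (polar p))"
      by (simp add: F_def cbox_interval)
  qed
  also have "\<dots> = 2 * pi * integral polar_box (\<lambda>p. fst p * cmod (deriv R (polar p)) * kernel_diag n (polar p))"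
    by (rule integral_mult_right)
  finally show ?thesis by simp
qed

text \<open>The Cauchy-Schwarz inequality, in the form \<open>2 * x * y \<le> l * x^2 + y^2 / l\<close> with the value of
  \<open>l\<close> for which both terms have the same bound.\<close>

lemma integral_norm_deriv_le_sqrt:
  assumes U: "open U" "cball 0 1 \<subseteq> U" and R: "R holomorphic_on U"
    and T: "T holomorphic_on cball 0 1" and TR: "\<And>t. cnj (R (cis t)) * blaschke_product n (cis t) = T (cis t)"
    and area: "integral polar_box (\<lambda>p. fst p * (cmod (deriv R (polar p)))\<^sup>2) \<le> pi" and n: "n \<ge> 1"
  shows "integral {0..2*pi} (\<lambda>t. cmod (deriv R (cis t))) \<le> 2 * pi * sqrt (32 * n)"
proof -
  have cR: "continuous_on (cball 0 1) (deriv R)"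
    by (intro holomorphic_on_imp_continuous_on holomorphic_on_subset[OF _ U(2)] holomorphic_deriv R U(1))
  note cRp = continuous_on_compose_polar[OF cR]
  define l where "l = sqrt (32 * n)"
  have l: "l > 0" "l\<^sup>2 = 32 * n" using n by (auto simp: l_def)
  have "2 * integral polar_box (\<lambda>p. fst p * cmod (deriv R (polar p)) * kernel_diag n (polar p))
      = integral polar_box (\<lambda>p. 2 * (fst p * cmod (deriv R (polar p)) * kernel_diag n (polar p)))"
    by simp
  also have "\<dots> \<le> integral polar_box (\<lambda>p. l * (fst p * (cmod (deriv R (polar p)))\<^sup>2) + (1 / l) * (fst p * (kernel_diag n (polar p))\<^sup>2))"
  proof (rule integral_le)
    fix p assume "p \<in> polar_box"
    then have "fst p \<ge> 0" by (cases p) auto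
    define x y where "x = cmod (deriv R (polar p))" and "y = kernel_diag n (polar p)"
    have "2 * (x * y) \<le> l * x\<^sup>2 + (1 / l) * y\<^sup>2"
    proof -
      have "0 \<le> (l * x - y)\<^sup>2 / l" using l by simp
      also have "\<dots> = l * x\<^sup>2 + (1 / l) * y\<^sup>2 - 2 * (x * y)" using l by (simp add: power2_eq_square field_simps)
      finally show ?thesis by simp
    qed
    from mult_left_mono[OF this \<open>fst p \<ge> 0\<close>]
    show "2 * (fst p * cmod (deriv R (polar p)) * kernel_diag n (polar p)) \<le> l * (fst p * (cmod (deriv R (polar p)))\<^sup>2) + (1 / l) * (fst p * (kernel_diag n (polar p))\<^sup>2)"
      by (simp add: x_def y_def algebra_simps)
  qed (intro integrable_continuous continuous_intros cRp continuous_on_kernel_diag_polar)+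
  also have "\<dots> = integral polar_box (\<lambda>p. l * (fst p * (cmod (deriv R (polar p)))\<^sup>2)) + integral polar_box (\<lambda>p. (1 / l) * (fst p * (kernel_diag n (polar p))\<^sup>2))"
    by (intro integral_add integrable_continuous continuous_intros cRp continuous_on_kernel_diag_polar)
  also have "\<dots> = l * integral polar_box (\<lambda>p. fst p * (cmod (deriv R (polar p)))\<^sup>2) + (1 / l) * integral polar_box (\<lambda>p. fst p * (kernel_diag n (polar p))\<^sup>2)"
    by (simp only: integral_mult_right)
  also have "\<dots> \<le> l * pi + (1 / l) * (32 * pi * n)"
    using l area integral_kernel_diag_square_le by (intro add_mono mult_left_mono) auto
  also have "(1 / l) * (32 * pi * n) = pi * (l\<^sup>2 / l)" by (simp add: l)
  also have "l * pi + pi * (l\<^sup>2 / l) = 2 * pi * l" using l(1) by (simp add: power2_eq_square)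
  finally show ?thesis using integral_norm_deriv_le[OF U R T TR] by (simp add: l_def)
qed

end

section \<open>The area of the image\<close>

text \<open>The change of variables formula lives on \<open>real^2\<close>, whereas iterated integrals live on \<open>real \<times> real\<close> and
  holomorphic maps on the complex numbers.  The next lemmas translate between them.\<close>

definition vec2 :: "complex \<Rightarrow> real^2" where
  "vec2 z = vector [Re z, Im z]"

lemma vec2_nth [simp]: "vec2 z $ 1 = Re z" "vec2 z $ 2 = Im z"
  by (simp_all add: vec2_def)

lemma norm_vec2: "norm (vec2 z) = cmod z"
  by (simp add: norm_vec_def L2_set_def sum_2 cmod_def)

lemma bounded_linear_vec2: "bounded_linear vec2"
  by (rule bounded_linear_intro[of _ 1]) (auto simp: vec_eq_iff forall_2 norm_vec2)

lemma inj_vec2: "inj vec2"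
  by (rule injI) (metis complex_eqI vec2_nth)

lemma has_integral_vec2_cbox:
  assumes "(f has_integral I) (cbox (a, c) (b, d))"
  shows "((\<lambda>x::real^2. f (x $ 1, x $ 2)) has_integral I) (cbox (vector [a, c]) (vector [b, d]))"
proof -
  define g where "g = (\<lambda>x::real^2. (x $ 1, x $ 2))"
  define h where "h = (\<lambda>p::real\<times>real. vector [fst p, snd p] :: real^2)"
  have hg: "h (g x) = x" and gh: "g (h p) = p" for x :: "real^2" and p
    by (simp_all add: h_def g_def vec_eq_iff forall_2)
  have gbox: "g ` cbox u v = cbox (g u) (g v)" for u v
  proof -
    have "p \<in> g ` cbox u v \<longleftrightarrow> p \<in> cbox (g u) (g v)" for p
    proof -
      have "p \<in> g ` cbox u v \<longleftrightarrow> h p \<in> cbox u v" by (metis gh hg image_iff)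
      also have "\<dots> \<longleftrightarrow> p \<in> cbox (g u) (g v)"
        by (cases p) (auto simp: h_def g_def mem_box_cart forall_2)
      finally show ?thesis .
    qed
    then show ?thesis by blast
  qed
  have hbox: "h ` cbox u v = cbox (h u) (h v)" for u v
    using gbox[of "h u" "h v"] by (metis (no_types, lifting) gh hg image_cong image_image image_ident)
  have "((\<lambda>x. f (g x)) has_integral (1 / 1) *\<^sub>R I) (h ` cbox (a, c) (b, d))"
  proof (rule has_integral_twiddle[OF _ hg gh])
    show "continuous (at x) g" for x unfolding g_def by (intro continuous_intros)
    have ex2: "(\<exists>i::2. Q i) \<longleftrightarrow> Q 1 \<or> Q 2" for Q by (metis exhaust_2)
    have empty: "cbox u v = {} \<longleftrightarrow> v $ 1 < u $ 1 \<or> v $ 2 < u $ 2" for u v :: "real^2"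
      by (simp only: interval_eq_empty_cart ex2)
    have 12: "(1::2) \<noteq> 2" by simp
    show "measure lborel (g ` cbox u v) = 1 * measure lborel (cbox u v)" for u v
      unfolding gbox content_cbox_if_cart[of u v] empty UNIV_2
      unfolding g_def content_Pair by (auto simp: 12)
  qed (use gbox hbox assms in \<open>blast | simp\<close>)+
  then show ?thesis by (simp add: hbox) (simp add: g_def h_def)
qed

lemma inj_on_polar: "inj_on polar ({0<..<1} \<times> {0<..<2*pi})"
proof (rule inj_onI, clarsimp)
  fix r s r' s' :: real
  assume *: "polar (r, s) = polar (r', s')" "0 < r" "0 < r'" "0 < s" "s < 2*pi" "0 < s'" "s' < 2*pi"
  have "cmod (polar (r, s)) = \<bar>r\<bar>" for r s by (simp add: polar_def norm_mult)
  with * have r: "r = r'" by (metis abs_of_pos)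
  with * have "cis s = cis s'" by (simp add: polar_def)
  then obtain k :: int where k: "s = s' + 2 * pi * k" by (metis cis.simps sin_cos_eq_iff) 
  have "2 * pi * real_of_int k < 2 * pi * 1" "2 * pi * (- real_of_int k) < 2 * pi * 1"
    using * k by (simp_all only: mult_minus_right)
  from mult_left_less_imp_less[OF this(1)] mult_left_less_imp_less[OF this(2)]
  have "real_of_int k < 1" "- real_of_int k < 1" by simp_all
  then have "k = 0" by linarith
  with k r show "r = r' \<and> s = s'" by simp
qed

text \<open>In polar coordinates \<open>R\<close> has the Jacobian determinant \<open>r * \<bar>R'\<bar>^2\<close>.  As \<open>R\<close> is injective, the integral is the
  area of a subset of the unit disc.\<close>

lemma area_inj_on_le_pi:
  assumes U: "open U" "cball 0 1 \<subseteq> U" and R: "R holomorphic_on U"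
    and inj: "inj_on R (ball 0 1)" and bd: "\<And>z. norm z < 1 \<Longrightarrow> cmod (R z) \<le> 1"
  shows "integral polar_box (\<lambda>p. fst p * (cmod (deriv R (polar p)))\<^sup>2) \<le> pi"
proof -
  define I where "I = integral polar_box (\<lambda>p. fst p * (cmod (deriv R (polar p)))\<^sup>2)"
  define q where "q = (\<lambda>x::real^2. polar (x $ 1, x $ 2))"
  define S where "S = box (vector [0, 0] :: real^2) (vector [1, 2 * pi])"
  define f where "f = (\<lambda>x. vec2 (R (q x)))"
  define f' where "f' = (\<lambda>(x::real^2) (h::real^2). vec2 (deriv R (q x) * (of_real (h $ 1) * cis (x $ 2) + of_real (h $ 2) * (\<i> * q x))))"
  have cR: "continuous_on (cball 0 1) (deriv R)"
    by (intro holomorphic_on_imp_continuous_on holomorphic_on_subset[OF _ U(2)] holomorphic_deriv R U(1))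
  have "((\<lambda>p. fst p * (cmod (deriv R (polar p)))\<^sup>2) has_integral I) polar_box"
    unfolding I_def
    by (intro integrable_integral integrable_continuous continuous_intros continuous_on_compose_polar[OF cR])
  from has_integral_vec2_cbox[OF this]
  have int: "((\<lambda>x::real^2. x $ 1 * (cmod (deriv R (q x)))\<^sup>2) has_integral I) S"
    unfolding S_def q_def has_integral_open_interval by simp
  have S: "x \<in> S \<longleftrightarrow> 0 < x $ 1 \<and> x $ 1 < 1 \<and> 0 < x $ 2 \<and> x $ 2 < 2 * pi" for x :: "real^2"
    by (auto simp: S_def mem_box_cart forall_2)
  have qS: "norm (q x) < 1" if "x \<in> S" for x
    using that by (auto simp: S q_def polar_def norm_mult)
  have der: "(f has_derivative f' x) (at x within S)" if x: "x \<in> S" for x :: "real^2"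
  proof -
    have "q x \<in> U" using qS[OF x] U(2) by auto
    then have dR: "(R has_field_derivative deriv R (q x)) (at (q x))"
      using R U(1) by (auto intro: holomorphic_derivI)
    have nth: "((\<lambda>x::real^2. x $ i) has_derivative (\<lambda>h::real^2. h $ i)) (at x within S)" for i
      by (rule bounded_linear_imp_has_derivative[OF bounded_linear_vec_nth])
    have "(q has_derivative (\<lambda>h::real^2. of_real (h $ 1) * cis (x $ 2) + of_real (h $ 2) * (\<i> * q x))) (at x within S)"
      unfolding q_def polar_def fst_conv snd_conv
      by (rule derivative_eq_intros nth has_derivative_of_real refl)+ (auto simp: algebra_simps scaleR_conv_of_real)
    from has_derivative_compose[OF this has_field_derivative_imp_has_derivative[OF dR]]
    have "((\<lambda>x. R (q x)) has_derivative (\<lambda>h::real^2. deriv R (q x) * (of_real (h $ 1) * cis (x $ 2) + of_real (h $ 2) * (\<i> * q x)))) (at x within S)"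
      by simp
    from bounded_linear.has_derivative[OF bounded_linear_vec2 this]
    show ?thesis unfolding f_def f'_def .
  qed
  have det: "\<bar>det (matrix (f' x))\<bar> = x $ 1 * (cmod (deriv R (q x)))\<^sup>2" if x: "x \<in> S" for x :: "real^2"
  proof -
    define d where "d = deriv R (q x)"
    define c s where "c = cos (x $ 2)" and "s = sin (x $ 2)"
    have cs: "c\<^sup>2 + s\<^sup>2 = 1" by (simp add: c_def s_def)
    have "det (matrix (f' x)) = Re (d * cis (x $ 2)) * Im (d * (\<i> * q x)) - Re (d * (\<i> * q x)) * Im (d * cis (x $ 2))"
      by (simp add: det_2 matrix_def f'_def axis_def d_def)
    also have "\<dots> = x $ 1 * ((Re d)\<^sup>2 + (Im d)\<^sup>2) * (c\<^sup>2 + s\<^sup>2)"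
      by (simp add: q_def polar_def power2_eq_square algebra_simps flip: c_def s_def)
    also have "\<dots> = x $ 1 * (cmod d)\<^sup>2" by (simp add: cs cmod_power2)
    finally show ?thesis using x by (simp add: d_def S)
  qed
  have injf: "inj_on f S"
  proof (rule inj_onI)
    fix x y :: "real^2" assume xy: "x \<in> S" "y \<in> S" "f x = f y"
    then have "R (q x) = R (q y)" unfolding f_def using inj_vec2 by (auto dest: injD)
    with inj qS xy have "q x = q y" by (auto dest: inj_onD)
    then have "(x $ 1, x $ 2) = (y $ 1, y $ 2)"
      unfolding q_def using xy by (intro inj_onD[OF inj_on_polar]) (auto simp: S)
    then show "x = y" by (simp add: vec_eq_iff forall_2)
  qed
  have "((\<lambda>x. \<bar>det (matrix (f' x))\<bar>) has_integral I) S"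
    using int by (rule has_integral_eq[rotated]) (use det in auto)
  then have m: "f ` S \<in> lmeasurable" "measure lebesgue (f ` S) = I"
    using has_measure_differentiable_image[OF _ der injf] by (auto simp: S_def)
  have "f ` S \<subseteq> cball 0 1"
    using bd qS by (auto simp: f_def norm_vec2)
  then have "measure lebesgue (f ` S) \<le> measure lebesgue (cball 0 1 :: (real^2) set)"
    by (intro measure_mono_fmeasurable fmeasurableD m) auto
  also have "\<dots> = pi"
    by (simp add: content_cball_conv_ball circle_area)
  finally show ?thesis using m by (simp add: I_def)
qed

section \<open>The upper bound for rational functions\<close>

text \<open>Each root contributes its reflection in the circle; the remaining \<open>n - degree Q\<close> points are placed at
  the origin, where the factor is 1.\<close>

lemma poly_eq_prod_one_minus_cnj:
  fixes Q :: "complex poly"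
  assumes "degree Q \<le> n" and nz: "\<And>z. norm z \<le> 1 \<Longrightarrow> poly Q z \<noteq> 0"
  obtains c a where "c \<noteq> 0" "\<And>k. norm (a k) < 1" "\<And>z. poly Q z = c * (\<Prod>k<n. 1 - cnj (a k) * z)"
proof -
  obtain root where root: "smult (lead_coeff Q) (\<Prod>i<degree Q. [:- root i, 1:]) = Q"
    by (rule complex_poly_decompose')
  define d where "d = degree Q"
  define lc where "lc = lead_coeff Q"
  have Q: "poly Q z = lc * (\<Prod>i<d. z - root i)" for z
    by (subst root [symmetric]) (simp add: poly_prod d_def lc_def)
  have big: "norm (root i) > 1" if "i < d" for i
  proof (rule ccontr)
    assume "\<not> norm (root i) > 1"
    then have "poly Q (root i) \<noteq> 0" by (intro nz) auto
    moreover have "poly Q (root i) = 0" unfolding Q using that by (auto simp: prod_zero_iff)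
    ultimately show False by simp
  qed
  define a where "a = (\<lambda>k. if k < d then cnj (1 / root k) else 0)"
  show ?thesis
  proof
    show "lc * (\<Prod>i<d. - root i) \<noteq> 0" 
      using nz[of 0] Q[of 0] by simp
    show "norm (a k) < 1" for k using big[of k] by (auto simp: a_def norm_divide divide_simps)
    fix z
    have "(\<Prod>k<n. 1 - cnj (a k) * z) = (\<Prod>k<d. 1 - cnj (a k) * z)"
      using assms(1) by (intro prod.mono_neutral_right) (auto simp: a_def d_def)
    also have "(\<Prod>i<d. - root i) * \<dots> = (\<Prod>i<d. z - root i)"
    proof (subst prod.distrib [symmetric], rule prod.cong)
      fix i assume i: "i \<in> {..<d}"
      with big[of i] have "root i \<noteq> 0" by auto
      with i show "- root i * (1 - cnj (a i) * z) = z - root i" by (simp add: a_def field_simps)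
    qed simp
    finally show "poly Q z = lc * (\<Prod>i<d. - root i) * (\<Prod>k<n. 1 - cnj (a k) * z)"
      by (simp add: Q mult.assoc)
  qed
qed

lemma cnj_poly_circle:
  fixes P :: "complex poly"
  assumes "degree P \<le> n"
  shows "cis t ^ n * cnj (poly P (cis t)) = (\<Sum>i\<le>n. cnj (coeff P i) * cis t ^ (n - i))"
proof -
  have "poly P (cis t) = (\<Sum>i\<le>n. coeff P i * cis t ^ i)"
    using assms by (auto simp: poly_altdef le_degree intro!: sum.mono_neutral_left)
  then have "cis t ^ n * cnj (poly P (cis t)) = (\<Sum>i\<le>n. cis t ^ n * (cnj (coeff P i) * cnj (cis t) ^ i))"
    by (simp only: cnj_sum complex_cnj_mult complex_cnj_power sum_distrib_left)
  also have "\<dots> = (\<Sum>i\<le>n. cnj (coeff P i) * cis t ^ (n - i))"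
  proof (rule sum.cong)
    fix i assume "i \<in> {..n}"
    then have n: "cis t ^ n = cis t ^ (n - i) * cis t ^ i" by (simp flip: power_add)
    have 1: "cis t ^ i * cnj (cis t) ^ i = 1" by (simp only: cis_times_cnj_cis power_one flip: power_mult_distrib)
    have "cis t ^ n * (cnj (coeff P i) * cnj (cis t) ^ i) = cnj (coeff P i) * cis t ^ (n - i) * (cis t ^ i * cnj (cis t) ^ i)"
      unfolding n by (simp only: mult_ac)
    then show "cis t ^ n * (cnj (coeff P i) * cnj (cis t) ^ i) = cnj (coeff P i) * cis t ^ (n - i)"
      unfolding 1 by simp
  qed simp
  finally show ?thesis .
qed

lemma no_pole_imp_denominator_nonzero:
  fixes P Q :: "complex poly"
  assumes "Q \<noteq> 0" "coprime P Q" "\<not> is_pole (\<lambda>z. poly P z / poly Q z) z"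
  shows "poly Q z \<noteq> 0"
proof
  assume Qz: "poly Q z = 0"
  have Pz: "poly P z \<noteq> 0"
  proof
    assume "poly P z = 0"
    with Qz have "[:-z, 1:] dvd P" "[:-z, 1:] dvd Q" by (simp_all add: poly_eq_0_iff_dvd)
    with assms(2) have "is_unit [:-z, 1:]" by (rule coprime_common_divisor)
    then show False by (simp add: is_unit_iff_degree)
  qed
  have "filterlim (poly Q) (at 0) (at z)"
  proof (rule filterlim_atI)
    show "(poly Q \<longlongrightarrow> 0) (at z)"
      using tendsto_poly[OF tendsto_ident_at, of Q z] Qz by simp
    have "\<not> z islimpt {x. poly Q x = 0}"
      using poly_roots_finite[OF assms(1)] by (rule islimpt_finite)
    then show "\<forall>\<^sub>F x in at z. poly Q x \<noteq> 0"
      by (simp add: islimpt_iff_eventually)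
  qed
  with Pz have "is_pole (\<lambda>z. poly P z / poly Q z) z"
    by (intro is_pole_divide) auto
  with assms(3) show False by simp
qed

theorem ell_le_sqrt:
  assumes R: "R \<in> RU1 n" and n: "n \<ge> 1"
  shows "ell R \<le> sqrt (32 * n)"
proof -
  obtain P Q where PQ: "Q \<noteq> 0" "coprime P Q" "degree P \<le> n" "degree Q \<le> n" "R = (\<lambda>z. poly P z / poly Q z)"
    using R unfolding RU1_def rational_fun_of_degree_le_def by auto
  have nz: "poly Q z \<noteq> 0" if "norm z \<le> 1" for z
    using R PQ that by (intro no_pole_imp_denominator_nonzero) (auto simp: RU1_def)
  obtain c a where c: "c \<noteq> 0" "\<And>k. norm (a k) < 1" "\<And>z. poly Q z = c * (\<Prod>k<n. 1 - cnj (a k) * z)"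
    using poly_eq_prod_one_minus_cnj[OF PQ(4) nz] by blast
  interpret disc_points a by standard (rule c)
  define U where "U = {z. poly Q z \<noteq> 0}"
  have U: "open U" "cball 0 1 \<subseteq> U"
    unfolding U_def using nz by (auto intro!: open_Collect_neq continuous_intros)
  have holR: "R holomorphic_on U" unfolding PQ U_def by (intro holomorphic_intros) auto
  \<comment> \<open>With \<open>R = P / Q\<close>, the extension of \<open>cnj R * B\<close> is the reversed conjugate polynomial of \<open>P\<close> divided
  by the product of the \<open>1 - cnj (a k) * z\<close>, up to a constant.\<close>
  define T where "T = (\<lambda>z. (\<Sum>i\<le>n. cnj (coeff P i) * z ^ (n - i)) / (cnj c * (\<Prod>k<n. 1 - cnj (a k) * z)))"
  have holT: "T holomorphic_on cball 0 1"
    unfolding T_def using c denominator_nonzero by (intro holomorphic_intros) (auto simp: prod_zero_iff)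
  have TR: "cnj (R (cis t)) * blaschke_product n (cis t) = T (cis t)" for t
  proof -
    define d where "d = (\<Prod>k<n. 1 - cnj (a k) * cis t)"
    have d: "d \<noteq> 0" using denominator_nonzero by (auto simp: d_def prod_zero_iff)
    have "blaschke_product n (cis t) = (\<Prod>k<n. cis t * cnj (1 - cnj (a k) * cis t)) / d"
      by (simp only: blaschke_product_def blaschke_factor_def prod_dividef d_def cis_minus)
    also have "(\<Prod>k<n. cis t * cnj (1 - cnj (a k) * cis t)) = cis t ^ n * cnj d"
      by (simp only: prod.distrib d_def cnj_prod prod_constant card_lessThan)
    finally have Bcis: "blaschke_product n (cis t) = cis t ^ n * cnj d / d" .
    have "cnj (R (cis t)) = cnj (poly P (cis t)) / (cnj c * cnj d)"
      unfolding PQ(5) c(3) d_def by simp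
    then have "cnj (R (cis t)) * blaschke_product n (cis t) = cis t ^ n * cnj (poly P (cis t)) / (cnj c * d)"
      using d c(1) by (simp add: Bcis)
    then show ?thesis unfolding cnj_poly_circle[OF PQ(3)] T_def d_def .
  qed
  have cR: "continuous_on (cball 0 1) R"
    by (intro holomorphic_on_imp_continuous_on holomorphic_on_subset[OF holR U(2)])
  have bd1: "cmod (R z) \<le> 1" if "z \<in> sphere 0 1" for z
  proof -
    have "compact ((\<lambda>z. cmod (R z)) ` sphere 0 1)"
      by (intro compact_continuous_image continuous_intros continuous_on_subset[OF cR]) auto
    then have "bdd_above ((\<lambda>z. cmod (R z)) ` sphere 0 1)" by (intro bounded_imp_bdd_above compact_imp_bounded)
    then have "cmod (R z) \<le> (SUP \<zeta>\<in>sphere 0 1. cmod (R \<zeta>))" using that by (intro cSUP_upper)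
    also have "\<dots> \<le> 1" using R by (simp add: RU1_def)
    finally show ?thesis .
  qed
  have bd: "cmod (R z) \<le> 1" if "norm z < 1" for z
  proof (rule maximum_modulus_frontier[of R "ball 0 1"])
    have "interior (ball 0 1) \<subseteq> U" using U(2) by auto
    then show "R holomorphic_on interior (ball 0 1)" by (rule holomorphic_on_subset[OF holR])
  qed (use that bd1 cR in auto)
  have area: "integral polar_box (\<lambda>p. fst p * (cmod (deriv R (polar p)))\<^sup>2) \<le> pi"
    using R bd by (intro area_inj_on_le_pi[OF U holR]) (auto simp: RU1_def)
  from integral_norm_deriv_le_sqrt[OF U holR holT TR area n] show ?thesis
    by (simp add: ell_def field_simps)
qed

section \<open>A rational approximation of a small negative power\<close>

lemma inj_on_if_Re_deriv_pos:
  assumes "convex S" "\<And>x. x \<in> S \<Longrightarrow> (f has_field_derivative f' x) (at x)" "\<And>x. x \<in> S \<Longrightarrow> 0 < Re (f' x)"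
  shows "inj_on f S"
proof (rule inj_onI, rule ccontr)
  fix x y assume xy: "x \<in> S" "y \<in> S" "f x = f y" "x \<noteq> y"
  have seg: "closed_segment x y \<subseteq> S" using assms(1) xy by (simp add: closed_segment_subset)
  have "\<exists>u. u \<in> closed_segment x y \<and> Re (f y / (y - x)) - Re (f x / (y - x)) = Re (f' u / (y - x) * (y - x))"
    by (rule complex_mvt_line) (use seg assms(2) in \<open>auto intro!: DERIV_cdivide\<close>)
  then obtain u where "u \<in> closed_segment x y" "Re (f' u) = 0" using xy by auto
  with seg assms(3) show False by fastforce
qed

lemma norm_add_of_real_ge:
  fixes x :: complex and b :: real
  assumes "Re x \<ge> 0" "b \<ge> 0"
  shows "norm (x + of_real b) \<ge> norm x" "norm (x + of_real b) \<ge> b"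
    "(norm x + b)\<^sup>2 \<le> 2 * (norm (x + of_real b))\<^sup>2"
proof -
  have e: "(norm (x + of_real b))\<^sup>2 = (norm x)\<^sup>2 + b\<^sup>2 + 2 * b * Re x"
    by (simp only: cmod_power2) (simp add: power2_eq_square algebra_simps)
  have p: "2 * b * Re x \<ge> 0" using assms by simp
  show "norm (x + of_real b) \<ge> norm x" by (rule power2_le_imp_le) (use e p in auto)
  show "norm (x + of_real b) \<ge> b" by (rule power2_le_imp_le) (use e p in auto)
  have "0 \<le> (norm x - b)\<^sup>2" by simp
  then show "(norm x + b)\<^sup>2 \<le> 2 * (norm (x + of_real b))\<^sup>2"
    using e p by (simp add: power2_eq_square algebra_simps)
qed

text \<open>The zeros \<open>- a j\<close> and poles \<open>- b j\<close> of \<open>h\<close> alternate.  The poles form a geometric progression of ratio \<open>9/8\<close>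
  from \<open>eps / 8\<close> to \<open>24\<close>, that is, they cover all scales of the set \<open>eps \<le> \<bar>x\<bar> \<le> 3\<close> with a margin of a factor 8
  on both sides.  Each zero lies a fraction \<open>1 / N\<close> of the way from its pole to the next one, so
  that \<open>h ^ N\<close> imitates a function with one zero at each \<open>- b (j + 1)\<close> and one pole at each \<open>- b j\<close>, which
  telescopes to \<open>(x + 24) / (x + eps / 8)\<close>, roughly a multiple of \<open>1 / x\<close>.  The bound \<open>N \<ge> 12\<close>
  keeps \<open>\<bar>h\<bar>\<close> at most 3 halfway between the spikes (\<open>norm_h_valley\<close>).\<close>

locale spikes =
  fixes N :: nat
  assumes N: "N \<ge> 12"
begin

definition eps :: real where "eps = 192 / (9/8) ^ (64 * N)"
definition b :: "nat \<Rightarrow> real" where "b j = eps / 8 * (9/8) ^ j"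
definition a :: "nat \<Rightarrow> real" where "a j = b j * (1 + 1 / (8 * N))"

definition h :: "complex \<Rightarrow> complex" where
  "h x = (\<Prod>j<64 * N. (x + of_real (a j)) / (x + of_real (b j)))"

text \<open>This is \<open>- N * h' x / h x\<close>, see \<open>DERIV_h\<close>.\<close>

definition log_deriv :: "complex \<Rightarrow> complex" where
  "log_deriv x = (\<Sum>j<64 * N. of_real (b j / 8) / ((x + of_real (a j)) * (x + of_real (b j))))"

lemma eps: "0 < eps" "eps \<le> 1"
proof -
  have "(192::real) \<le> (9/8) ^ 64" by (simp add: power_divide)
  also have "\<dots> \<le> (9/8) ^ (64 * N)" using N by (intro power_increasing) auto
  finally show "eps \<le> 1" by (simp add: eps_def)
qed (simp add: eps_def)

lemma b_pos: "0 < b j" and a_pos: "0 < a j"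
  using eps by (auto simp: b_def a_def intro!: mult_pos_pos add_pos_nonneg)

lemma b_bounds: "b 0 = eps / 8" "b (64 * N) = 24" "b (Suc j) = 9/8 * b j"
  by (auto simp: b_def eps_def)

lemma a_bounds: "b j \<le> a j" "a j \<le> b (Suc j)"
proof -
  have "0 \<le> 1 / (8 * real N)" "1 / (8 * real N) \<le> 1 / 8" using N by (auto simp: field_simps)
  then show "b j \<le> a j" "a j \<le> b (Suc j)"
    using b_pos[of j] mult_left_mono[of "1 / (8 * real N)" "1 / 8" "b j"]
    unfolding a_def b_bounds(3) by (simp_all add: algebra_simps)
qed

lemma denominators_nonzero: "Re x \<ge> 0 \<Longrightarrow> x + of_real (b j) \<noteq> 0" "Re x \<ge> 0 \<Longrightarrow> x + of_real (a j) \<noteq> 0"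
  using b_pos[of j] a_pos[of j] by (auto simp: complex_eq_iff)

lemma h_nonzero: "Re x \<ge> 0 \<Longrightarrow> h x \<noteq> 0"
  unfolding h_def using denominators_nonzero by (auto simp: prod_zero_iff)

lemma DERIV_h:
  assumes "Re x \<ge> 0"
  shows "(h has_field_derivative - h x * log_deriv x / N) (at x)"
proof -
  let ?f = "\<lambda>j x. (x + complex_of_real (a j)) / (x + of_real (b j))"
  let ?f' = "\<lambda>j. of_real (b j - a j) / (x + complex_of_real (b j))\<^sup>2"
  have d: "(?f j has_field_derivative ?f' j) (at x)" for j
    using denominators_nonzero[OF assms] by (auto intro!: derivative_eq_intros simp: power2_eq_square field_simps)
  have "((\<lambda>x. \<Prod>j<64*N. ?f j x) has_field_derivative (\<Prod>j<64*N. ?f j x) * (\<Sum>j<64*N. ?f' j / ?f j x)) (at x)"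
    by (rule has_field_derivative_prod') (use d denominators_nonzero[OF assms] in auto)
  moreover have "(\<Sum>j<64*N. ?f' j / ?f j x) = - log_deriv x / N"
  proof -
    have e2: "?f' j / ?f j x = - (of_real (b j / 8) / ((x + of_real (a j)) * (x + of_real (b j)))) / N" for j
  proof -
    have e: "complex_of_real (b j - a j) = - of_real (b j / 8) / N"
      unfolding a_def using N by (simp add: field_simps)
    show ?thesis unfolding e using denominators_nonzero[OF assms, of j] N by (simp add: power2_eq_square)
    qed
    show ?thesis unfolding e2 log_deriv_def by (simp only: sum_negf[symmetric] sum_divide_distrib)
  qed
  ultimately show ?thesis by (simp add: h_def[abs_def])
qed

text \<open>The number \<open>1 - x * log_deriv x\<close> is \<open>x\<close> times the logarithmic derivative of \<open>x * h x ^ N\<close>, and it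
  vanishes if \<open>h x ^ N\<close> is replaced by a multiple of \<open>1 / x\<close>.  The \<open>j\<close>-th summand \<open>s j\<close> of \<open>x * log_deriv x\<close> is
  compared with \<open>c j = x / (x + b j) - x / (x + b (j + 1))\<close>, whose sum telescopes to \<open>1\<close> up to
  end terms of size \<open>1/8\<close> each.  The error of the comparison is controlled by the same telescoping sum
  for \<open>X = \<bar>x\<bar>\<close> instead of \<open>x\<close>, which is positive; passing from \<open>x\<close> to \<open>\<bar>x\<bar>\<close> costs a bounded factor in the
  right half-plane, and the mesh width \<open>9/8 - 1\<close> makes the total error at most \<open>1/4\<close>.\<close>

lemma norm_one_minus_x_log_deriv_le:
  assumes x: "Re x > 0" "eps \<le> norm x" "norm x \<le> 3"
  shows "norm (1 - x * log_deriv x) \<le> 1 / 2"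
proof -
  define X where "X = norm x"
  have X: "X > 0" using x(2) eps(1) unfolding X_def by linarith
  have Re0: "Re x \<ge> 0" using x by simp
  define c where "c = (\<lambda>j. x / (x + of_real (b j)) - x / (x + of_real (b (Suc j))))"
  define t where "t = (\<lambda>j. X / (X + b j) - X / (X + b (Suc j)))"
  define s where "s = (\<lambda>j. x * (of_real (b j / 8) / ((x + of_real (a j)) * (x + of_real (b j)))))"
  have diff: "norm (c j - s j) \<le> 1 / 4 * t j" for j
  proof -
    have b: "b j > 0" using b_pos .
    have nzs: "x + of_real (b j) \<noteq> 0" "x + of_real (b (Suc j)) \<noteq> 0" "x + of_real (a j) \<noteq> 0"
      using denominators_nonzero[OF Re0] by auto
    define p q r where "p = norm (x + of_real (b j))" and "q = norm (x + of_real (b (Suc j)))" and "r = norm (x + of_real (a j))"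
    have pqr: "p > 0" "q > 0" "r > 0" using nzs by (auto simp: p_def q_def r_def)
    have "c j - s j = x * of_real (b j / 8) * of_real (a j - b (Suc j)) /
        ((x + of_real (b j)) * (x + of_real (b (Suc j))) * (x + of_real (a j)))"
      using nzs unfolding c_def s_def b_bounds(3) by (simp add: divide_simps) (simp add: algebra_simps)
    then have "norm (c j - s j) = X * (b j / 8) * (b (Suc j) - a j) / (p * q * r)"
      using a_bounds[of j] b by (simp add: norm_mult norm_divide X_def p_def q_def r_def del: of_real_diff of_real_divide)
    also have "\<dots> \<le> X * (b j / 8) * (r / 8) / (p * q * r)"
    proof -
      have "b (Suc j) - a j \<le> b j / 8" using a_bounds[of j] by (simp add: b_bounds)
      also have "\<dots> \<le> r / 8"
        using norm_add_of_real_ge(2)[OF Re0, of "a j"] a_bounds[of j] b by (simp add: r_def)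
      finally show ?thesis using pqr X b by (intro divide_right_mono mult_left_mono) auto
    qed
    also have "\<dots> = X * (b j / 8) / 8 / (p * q)" using pqr by simp
    also have "\<dots> \<le> X * (b j / 8) / 8 * (2 / ((X + b j) * (X + b (Suc j))))"
    proof -
      have "((X + b j) * (X + b (Suc j)))\<^sup>2 \<le> (2 * p\<^sup>2) * (2 * q\<^sup>2)"
        unfolding power_mult_distrib X_def p_def q_def
        using norm_add_of_real_ge(3)[OF Re0] b_pos by (intro mult_mono) (auto simp: less_imp_le)
      also have "\<dots> = (2 * (p * q))\<^sup>2" by (simp add: power_mult_distrib)
      finally have "(X + b j) * (X + b (Suc j)) \<le> 2 * (p * q)"
        by (rule power2_le_imp_le) (use pqr in auto)
      moreover have "(X + b j) * (X + b (Suc j)) > 0" using X b_pos by (intro mult_pos_pos add_pos_pos) auto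
      ultimately have "1 / (p * q) \<le> 2 / ((X + b j) * (X + b (Suc j)))"
        using pqr by (simp add: field_simps)
      from mult_left_mono[OF this, of "X * (b j / 8) / 8"] show ?thesis using X b by simp
    qed
    also have "\<dots> = 1 / 4 * t j"
    proof -
      have "X + b j \<noteq> 0" "X + b (Suc j) \<noteq> 0" using X b_pos[of j] b_pos[of "Suc j"] by auto
      then show ?thesis unfolding t_def b_bounds(3) by (simp add: divide_simps) (simp add: algebra_simps)
    qed
    finally show ?thesis .
  qed
  have sums: "x * log_deriv x = (\<Sum>j<64*N. s j)" by (simp add: log_deriv_def s_def sum_distrib_left)
  have tel: "(\<Sum>j<64*N. c j) = x / (x + of_real (b 0)) - x / (x + of_real (b (64*N)))"
    unfolding c_def by (rule sum_lessThan_telescope')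
  have telt: "(\<Sum>j<64*N. t j) = X / (X + b 0) - X / (X + b (64*N))"
    unfolding t_def by (rule sum_lessThan_telescope')
  have "X / (X + b 0) \<le> 1" "0 \<le> X / (X + b (64*N))" using X b_pos less_imp_le by (auto simp: field_simps add_pos_pos)
  then have t1: "(\<Sum>j<64*N. t j) \<le> 1" unfolding telt by linarith
  have "1 - x * log_deriv x = of_real (b 0) / (x + of_real (b 0)) + x / (x + of_real (b (64*N))) + (\<Sum>j<64*N. c j - s j)"
  proof -
    have "1 - x / (x + of_real (b 0)) = of_real (b 0) / (x + of_real (b 0))"
      using denominators_nonzero(1)[OF Re0, of 0] by (simp add: field_simps)
    then show ?thesis unfolding sum_subtractf tel sums by (simp add: algebra_simps)
  qed
  then have "norm (1 - x * log_deriv x) \<le> norm (of_real (b 0) / (x + of_real (b 0))) + norm (x / (x + of_real (b (64*N)))) + norm (\<Sum>j<64*N. c j - s j)"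
    by (simp only:) (intro norm_triangle_le add_mono norm_triangle_ineq order_refl)
  also have "norm (of_real (b 0) / (x + of_real (b 0))) \<le> 1 / 8"
  proof -
    have "norm (of_real (b 0) / (x + of_real (b 0))) = b 0 / norm (x + of_real (b 0))"
      using b_pos[of 0] by (simp add: norm_divide)
    also have "\<dots> \<le> b 0 / norm x"
      using norm_add_of_real_ge(1)[OF Re0, of "b 0"] b_pos[of 0] X by (intro divide_left_mono mult_pos_pos) (auto simp: X_def)
    also have "\<dots> \<le> 1 / 8" using x(2) X by (simp add: b_bounds X_def field_simps)
    finally show ?thesis .
  qed
  also have "norm (x / (x + of_real (b (64*N)))) \<le> 1 / 8"
  proof -
    have "norm (x + of_real (b (64*N))) \<ge> 24"
      using norm_add_of_real_ge(2)[OF Re0, of "b (64*N)"] by (simp add: b_bounds)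
    then have "norm x / norm (x + of_real (b (64*N))) \<le> 3 / 24" using x(3) by (intro frac_le) auto
    then show ?thesis by (simp add: norm_divide)
  qed
  also have "norm (\<Sum>j<64*N. c j - s j) \<le> (\<Sum>j<64*N. 1 / 4 * t j)"
    by (rule sum_norm_le) (rule diff)
  also have "\<dots> \<le> 1 / 4" using t1 by (simp flip: sum_divide_distrib)
  finally show ?thesis by simp
qed

text \<open>In the coordinate \<open>y = Ln x\<close> the function \<open>L y = Ln (x * h x ^ N)\<close> has derivative at most \<open>1/2\<close> in modulus and is
  real on the real axis.  Integrating vertically over at most \<open>\<pi> / 2\<close>, its imaginary part is at most
  \<open>\<pi> / 4\<close>.  The last factor lies in the disc of radius \<open>1/2\<close> around \<open>1 + eps\<close>, and
  \<open>cos (\<pi> / 4) = sqrt 2 / 2\<close> exceeds \<open>1/2\<close>.\<close>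

lemma Re_x_h_power_pos:
  assumes x: "Re x > 0" "eps \<le> norm x" "norm x \<le> 3" and w: "norm w \<le> 1"
  shows "Re (x * h x ^ N * (1 + eps - w * (1 - x * log_deriv x))) > 0"
proof -
  define L where "L = (\<lambda>y. y + N * (\<Sum>j<64 * N. Ln (exp y + of_real (a j)) - Ln (exp y + of_real (b j))))"
  define y where "y = Ln x"
  have "norm x > 0" using x(2) eps(1) by linarith
  then have x0: "x \<noteq> 0" by simp
  have Imy: "\<bar>Im y\<bar> < pi / 2" unfolding y_def using Re_Ln_pos_lt[OF x0] x by simp
  have expy: "exp y = x" unfolding y_def using x0 by simp
  have seg: "Re (exp v) > 0 \<and> norm (exp v) = norm x" if "v \<in> closed_segment (of_real (Re y)) y" for v
  proof -
    from that[unfolded in_segment] obtain u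
      where "0 \<le> u \<and> u \<le> 1 \<and> v = (1 - u) *\<^sub>R of_real (Re y) + u *\<^sub>R y" ..
    then have u: "0 \<le> u" "u \<le> 1" "v = (1 - u) *\<^sub>R of_real (Re y) + u *\<^sub>R y" by simp_all
    have v: "Re v = Re y" "Im v = u * Im y" unfolding u(3) by (simp_all add: algebra_simps)
    have "\<bar>Im v\<bar> \<le> \<bar>Im y\<bar>" unfolding v abs_mult using u(1,2) by (simp add: mult_left_le_one_le)
    then have "- (pi / 2) < Im v" "Im v < pi / 2" using Imy by linarith+
    then have "cos (Im v) > 0" by (rule cos_gt_zero_pi)
    moreover have "norm (exp v) = norm (exp y)" unfolding norm_exp_eq_Re v ..
    ultimately show ?thesis unfolding expy using x0 by (simp add: Re_exp)
  qed
  have DL: "(L has_field_derivative 1 - exp v * log_deriv (exp v)) (at v)" if "Re (exp v) > 0" for v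
  proof -
    have Ln: "((\<lambda>v. Ln (exp v + of_real r)) has_field_derivative exp v / (exp v + of_real r)) (at v)" if "r > 0" for r
    proof -
      have 1: "exp v + of_real r \<notin> \<real>\<^sub>\<le>\<^sub>0"
        using \<open>Re (exp v) > 0\<close> that unfolding complex_nonpos_Reals_iff plus_complex.sel Re_complex_of_real by linarith
      have 2: "((\<lambda>v. exp v + of_real r) has_field_derivative exp v) (at v)"
        by (rule derivative_eq_intros refl)+ simp
      show ?thesis
        using DERIV_chain2[OF has_field_derivative_Ln[OF 1] 2] by (simp add: divide_inverse mult.commute)
    qed
    have "(L has_field_derivative 1 + N * (\<Sum>j<64 * N. exp v / (exp v + of_real (a j)) - exp v / (exp v + of_real (b j)))) (at v)"
      unfolding L_def by (intro DERIV_add DERIV_ident DERIV_cmult DERIV_sum DERIV_diff Ln a_pos b_pos)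
    moreover have "N * (\<Sum>j<64 * N. exp v / (exp v + of_real (a j)) - exp v / (exp v + of_real (b j))) = - exp v * log_deriv (exp v)"
      unfolding log_deriv_def sum_distrib_left
    proof (rule sum.cong[OF refl])
      fix j
      have nz': "exp v + of_real (b j) \<noteq> 0" "exp v + of_real (a j) \<noteq> 0" using denominators_nonzero that by auto
      have e: "complex_of_real (b j) - of_real (a j) = - of_real (b j / 8) / N"
        unfolding a_def using N by (simp add: field_simps)
      have "exp v / (exp v + of_real (a j)) - exp v / (exp v + of_real (b j)) = 
         exp v * (complex_of_real (b j) - of_real (a j)) / ((exp v + of_real (a j)) * (exp v + of_real (b j)))"
        using nz' by (simp add: divide_simps) (simp add: algebra_simps)
      then show "N * (exp v / (exp v + of_real (a j)) - exp v / (exp v + of_real (b j))) 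
        = - exp v * (of_real (b j / 8) / ((exp v + of_real (a j)) * (exp v + of_real (b j))))"
        unfolding e using N by simp
    qed
    ultimately show ?thesis by simp
  qed
  have "norm (L y - L (of_real (Re y))) \<le> 1 / 2 * norm (y - of_real (Re y))"
  proof (rule field_differentiable_bound[OF convex_closed_segment[of "of_real (Re y)" y]])
    fix v assume "v \<in> closed_segment (of_real (Re y)) y"
    with seg have v: "Re (exp v) > 0" "norm (exp v) = norm x" by auto
    show "(L has_field_derivative 1 - exp v * log_deriv (exp v)) (at v within closed_segment (of_real (Re y)) y)"
      by (rule has_field_derivative_at_within[OF DL[OF v(1)]])
    show "norm (1 - exp v * log_deriv (exp v)) \<le> 1 / 2"
      by (rule norm_one_minus_x_log_deriv_le) (use v x in auto)
  qed auto
  also have "norm (y - of_real (Re y)) = \<bar>Im y\<bar>"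
    by (metis add_diff_cancel_left' complex_eq norm_ii norm_mult norm_of_real mult_1)
  also have "1 / 2 * \<bar>Im y\<bar> \<le> pi / 4" using Imy by simp
  finally have "\<bar>Im (L y - L (of_real (Re y)))\<bar> \<le> pi / 4" using abs_Im_le_cmod order_trans by blast
  moreover have "Im (L (of_real (Re y))) = 0"
  proof -
    have "Im (Ln (exp (of_real (Re y)) + complex_of_real r)) = 0" if "r > 0" for r
    proof -
      have "exp (complex_of_real (Re y)) + of_real r = of_real (exp (Re y) + r)" by (simp add: exp_of_real)
      moreover have "exp (Re y) + r > 0" using that by (simp add: add_pos_pos)
      ultimately show ?thesis by (metis Ln_of_real Im_complex_of_real)
    qed
    then show ?thesis using a_pos b_pos by (simp add: L_def Im_sum)
  qed
  ultimately have ImL: "\<bar>Im (L y)\<bar> \<le> pi / 4" by simp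
  have expL: "exp (L y) = x * h x ^ N"
  proof -
    have "exp (\<Sum>j<64 * N. Ln (x + of_real (a j)) - Ln (x + of_real (b j))) = h x"
      unfolding h_def exp_sum[OF finite_lessThan] using denominators_nonzero[of x] x by (intro prod.cong) (auto simp: exp_diff)
    then show ?thesis by (simp add: L_def exp_add expy exp_of_nat_mult)
  qed
  define v where "v = w * (1 - x * log_deriv x)"
  have "norm v \<le> 1 * (1 / 2)"
    unfolding v_def norm_mult using w norm_one_minus_x_log_deriv_le[OF x] by (intro mult_mono) auto
  then have v: "norm v \<le> 1 / 2" by simp
  have c: "cos (Im (L y)) \<ge> sqrt 2 / 2"
  proof -
    have "cos (pi / 4) \<le> cos \<bar>Im (L y)\<bar>" using ImL by (intro cos_monotone_0_pi_le) auto
    then show ?thesis by (simp add: cos_45 cos_abs_real)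
  qed
  have "exp (L y) = of_real (exp (Re (L y))) * cis (Im (L y))" by (rule exp_eq_polar)
  then have polar: "Re (exp (L y) * (1 + eps - v)) = exp (Re (L y)) * Re (cis (Im (L y)) * (1 + eps - v))"
    by (simp only: mult.assoc Re_complex_of_real Im_complex_of_real times_complex.sel mult_zero_left diff_0_right)
  have "Re (cis (Im (L y)) * (1 + eps - v)) = (1 + eps) * cos (Im (L y)) - Re (cis (Im (L y)) * v)"
    by (simp add: algebra_simps)
  also have "\<dots> > 0"
  proof -
    have "Re (cis (Im (L y)) * v) \<le> norm (cis (Im (L y)) * v)" by (rule complex_Re_le_cmod)
    also have "\<dots> \<le> 1 / 2" using v by (simp add: norm_mult)
    also have "1 / 2 < sqrt 2 / 2" by simp
    also have "\<dots> \<le> (1 + eps) * cos (Im (L y))" using c eps mult_mono[of 1 "1 + eps" "sqrt 2 / 2" "cos (Im (L y))"] by simp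
    finally show ?thesis by simp
  qed
  finally have "Re (exp (L y) * (1 + eps - v)) > 0"
    unfolding polar by (intro mult_pos_pos exp_gt_zero)
  then show ?thesis by (simp only: expL v_def)
qed

section \<open>Univalence of the star map\<close>

lemma shifted_disc_bounds:
  fixes w :: complex
  assumes "norm w < 1"
  shows "Re (1 + eps - w) > 0" "eps \<le> norm (1 + eps - w)" "norm (1 + eps - w) \<le> 3"
proof -
  have "Re w < 1" using assms complex_Re_le_cmod[of w] by linarith
  then show "Re (1 + eps - w) > 0" using eps by simp
  have "Re (1 + eps - w) \<le> norm (1 + eps - w)" by (rule complex_Re_le_cmod)
  then show "eps \<le> norm (1 + eps - w)" using \<open>Re w < 1\<close> by simp
  have "norm (1 + eps - w) \<le> norm (of_real (1 + eps) :: complex) + norm w"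
    using norm_triangle_ineq4[of "of_real (1 + eps)" w] by simp
  also have "norm (of_real (1 + eps) :: complex) = 1 + eps" unfolding norm_of_real using eps by simp
  finally show "norm (1 + eps - w) \<le> 3" using eps assms by simp
qed

text \<open>The function \<open>w * h (1 + eps - w) ^ N\<close> in the coordinate \<open>y = 1 / (1 + eps - w)\<close>.  For the
  model \<open>h x ^ N = 1 / x\<close> it is the affine map \<open>(1 + eps) * y - 1\<close>, so its derivative is expected to
  be close to a positive constant.\<close>

definition inverted_power :: "complex \<Rightarrow> complex" where
  "inverted_power y = (of_real (1 + eps) - 1 / y) * h (1 / y) ^ N"

lemma DERIV_inverted_power:
  fixes y :: complex
  assumes y: "y \<noteq> 0" and w: "norm (1 + eps - 1 / y) < 1"
  shows "(inverted_power has_field_derivative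
     (1 / y) * h (1 / y) ^ N * (1 + eps - (1 + eps - 1 / y) * (1 - (1 / y) * log_deriv (1 / y)))) (at y)"
proof -
  define x where "x = 1 / y"
  have x: "Re x > 0" using shifted_disc_bounds(1)[OF w] by (simp add: x_def)
  have d1: "((\<lambda>y. 1 / y) has_field_derivative - (x\<^sup>2)) (at y)"
    using y by (auto intro!: derivative_eq_intros simp: x_def power2_eq_square field_simps)
  have d2: "((\<lambda>y. h (1 / y)) has_field_derivative (- h x * log_deriv x / N) * - (x\<^sup>2)) (at y)"
  proof (rule DERIV_chain2[OF _ d1])
    show "(h has_field_derivative - h x * log_deriv x / N) (at (1 / y))"
      using DERIV_h[of x] x by (simp add: x_def)
  qed
  have d3: "((\<lambda>y. 1 + eps - 1 / y) has_field_derivative x\<^sup>2) (at y)"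
    using DERIV_diff[OF DERIV_const d1, of "1 + eps"] by simp
  have "(inverted_power has_field_derivative
      x\<^sup>2 * h x ^ N + (of_nat N * ((- h x * log_deriv x / N) * - (x\<^sup>2)) * h x ^ (N - 1)) * (1 + eps - x)) (at y)"
    unfolding inverted_power_def[abs_def]
    by (rule DERIV_cong[OF DERIV_mult[OF d3 DERIV_power[OF d2, of N]]]) (simp only: x_def One_nat_def mult_ac)
  moreover have "of_nat N * ((- h x * log_deriv x / N) * - (x\<^sup>2)) * h x ^ (N - 1) = x\<^sup>2 * log_deriv x * h x ^ N"
  proof -
    have "h x ^ N = h x * h x ^ (N - 1)" using N by (cases N) auto
    then show ?thesis using N by simp
  qed
  moreover have "x\<^sup>2 * h x ^ N + x\<^sup>2 * log_deriv x * h x ^ N * (1 + eps - x) = x * h x ^ N * (1 + eps - (1 + eps - x) * (1 - x * log_deriv x))"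
    by (simp add: power2_eq_square algebra_simps)
  ultimately show ?thesis by (simp add: x_def)
qed

text \<open>The unit disc in the \<open>w\<close>-plane corresponds to a disc, hence to a convex set, in the \<open>y\<close>-plane.\<close>

lemma inversion_ball:
  fixes y :: complex
  defines "k \<equiv> (1 + eps)\<^sup>2 - 1"
  shows "y \<in> ball (of_real ((1 + eps) / k)) (1 / k) \<longleftrightarrow> norm ((1 + eps) * y - 1) < norm y"
proof -
  have k: "k > 0" using eps unfolding k_def by (simp add: power2_eq_square algebra_simps add_pos_pos)
  have sq: "s < t \<longleftrightarrow> s\<^sup>2 < t\<^sup>2" if "s \<ge> 0" "t \<ge> 0" for s t :: real
    using that by (metis power2_less_imp_less power_strict_mono zero_less_numeral)
  define E where "E = 1 + eps"
  have kE: "k = E\<^sup>2 - 1" by (simp add: k_def E_def)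
  have l: "(norm (of_real (E / k) - y))\<^sup>2 = (E / k - Re y)\<^sup>2 + (Im y)\<^sup>2"
    by (simp only: cmod_power2) simp
  have r: "(norm (of_real E * y - 1))\<^sup>2 = (E * Re y - 1)\<^sup>2 + (E * Im y)\<^sup>2"
    by (simp only: cmod_power2) simp
  have key: "k * ((E / k - Re y)\<^sup>2 + (Im y)\<^sup>2 - (1 / k)\<^sup>2) = (E * Re y - 1)\<^sup>2 + (E * Im y)\<^sup>2 - ((Re y)\<^sup>2 + (Im y)\<^sup>2)"
  proof -
    have "k * ((E / k - Re y)\<^sup>2 + (Im y)\<^sup>2 - (1 / k)\<^sup>2) = (E\<^sup>2 - 1) / k - 2 * E * Re y + k * (Re y)\<^sup>2 + k * (Im y)\<^sup>2"
      using k by (simp add: power2_eq_square field_simps)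
    also have "(E\<^sup>2 - 1) / k = 1" using k by (simp add: kE)
    finally show ?thesis by (simp add: kE power2_eq_square algebra_simps)
  qed
  have "y \<in> ball (of_real (E / k)) (1 / k) \<longleftrightarrow> (norm (of_real (E / k) - y))\<^sup>2 < (1 / k)\<^sup>2"
    unfolding mem_ball dist_norm using k by (intro sq) auto
  also have "\<dots> \<longleftrightarrow> k * ((E / k - Re y)\<^sup>2 + (Im y)\<^sup>2 - (1 / k)\<^sup>2) < 0"
    unfolding l using k by (simp add: mult_less_0_iff)
  also have "\<dots> \<longleftrightarrow> (norm (of_real E * y - 1))\<^sup>2 < (norm y)\<^sup>2"
    unfolding key r cmod_power2[of y] by simp
  also have "\<dots> \<longleftrightarrow> norm (of_real E * y - 1) < norm y" by (rule sq[symmetric]) auto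
  finally show ?thesis by (simp add: E_def)
qed

lemma inj_on_w_mult_h_power: "inj_on (\<lambda>w::complex. w * h (1 + eps - w) ^ N) (ball 0 1)"
proof -
  define k where "k = (1 + eps)\<^sup>2 - 1"
  define C where "C = ball (complex_of_real ((1 + eps) / k)) (1 / k)"
  have C: "y \<in> C \<longleftrightarrow> norm (of_real (1 + eps) * y - 1) < norm y" for y
    unfolding C_def k_def by (rule inversion_ball)
  have Cw: "y \<noteq> 0 \<and> norm (1 + eps - 1 / y) < 1" if "y \<in> C" for y :: complex
  proof -
    have y: "y \<noteq> 0" using that C[of y] by auto
    have "1 + eps - 1 / y = ((1 + eps) * y - 1) / y" using y by (simp add: field_simps)
    then have "norm (1 + eps - 1 / y) = norm ((1 + eps) * y - 1) / norm y" by (simp add: norm_divide)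
    also have "\<dots> < 1" using that C[of y] y by simp
    finally show ?thesis using y by simp
  qed
  have wC: "1 / (1 + eps - w) \<in> C" if "norm w < 1" for w :: complex
  proof -
    have denominators_nonzero: "1 + eps - w \<noteq> 0" using shifted_disc_bounds(1)[OF that] by auto
    then have "(1 + eps) * (1 / (1 + eps - w)) - 1 = w * (1 / (1 + eps - w))" by (simp add: field_simps)
    then have "norm ((1 + eps) * (1 / (1 + eps - w)) - 1) = norm w * norm (1 / (1 + eps - w))" by (simp only: norm_mult)
    also have "\<dots> < 1 * norm (1 / (1 + eps - w))" using denominators_nonzero that by (intro mult_strict_right_mono) auto
    finally show ?thesis unfolding C by simp
  qed
  have "inj_on inverted_power C"
  proof (rule inj_on_if_Re_deriv_pos[OF _ DERIV_inverted_power])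
    show "convex C" unfolding C_def by (rule convex_ball)
    fix y assume "y \<in> C"
    with Cw have y: "y \<noteq> 0" "norm (1 + eps - 1 / y) < 1" by auto
    show "y \<noteq> 0" "norm (1 + eps - 1 / y) < 1" by fact+
    show "0 < Re (1 / y * h (1 / y) ^ N * (1 + eps - (1 + eps - 1 / y) * (1 - 1 / y * log_deriv (1 / y))))"
      using Re_x_h_power_pos[of "1 / y" "1 + eps - 1 / y"] shifted_disc_bounds[OF y(2)] y(2) by simp
  qed
  show ?thesis
  proof (rule inj_onI)
    fix w w' :: complex
    assume *: "w \<in> ball 0 1" "w' \<in> ball 0 1" "w * h (1 + eps - w) ^ N = w' * h (1 + eps - w') ^ N"
    then have "inverted_power (1 / (1 + eps - w)) = inverted_power (1 / (1 + eps - w'))" by (simp add: inverted_power_def)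
    with \<open>inj_on inverted_power C\<close> have "1 / (1 + eps - w) = 1 / (1 + eps - w')"
      by (rule inj_onD) (use * wC in auto)
    then have "1 + eps - w = 1 + eps - w'" by (metis divide_divide_eq_right div_by_1 mult_1)
    then show "w = w'" by simp
  qed
qed

text \<open>The factor \<open>exp 8\<close> bounds \<open>\<bar>h\<bar>\<close> on the right half-plane (\<open>norm_h_le\<close>).\<close>

definition star_map :: "complex \<Rightarrow> complex" where
  "star_map z = z * h (of_real (1 + eps) - z ^ N) / of_real (exp 8)"

text \<open>Taking \<open>N\<close>-th powers turns an equality of values into an equality of values of
  \<open>w * h (1 + eps - w) ^ N\<close> at \<open>w = z ^ N\<close>.  So the \<open>N\<close>-th powers of the two points agree, the factors
  \<open>h\<close> agree and can be cancelled.\<close>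

lemma inj_on_star_map: "inj_on star_map (ball 0 1)"
proof (rule inj_onI)
  fix z z' :: complex assume z: "z \<in> ball 0 1" "z' \<in> ball 0 1" and "star_map z = star_map z'"
  then have eq: "z * h (1 + eps - z ^ N) = z' * h (1 + eps - z' ^ N)" by (simp add: star_map_def)
  then have "(z * h (1 + eps - z ^ N)) ^ N = (z' * h (1 + eps - z' ^ N)) ^ N" by simp
  then have "z ^ N * h (1 + eps - z ^ N) ^ N = z' ^ N * h (1 + eps - z' ^ N) ^ N" by (simp add: power_mult_distrib)
  moreover have zN: "norm (z ^ N) < 1" "norm (z' ^ N) < 1"
    using z N by (auto simp: norm_power power_less_one_iff)
  ultimately have "z ^ N = z' ^ N"
    using inj_onD[OF inj_on_w_mult_h_power, of "z ^ N" "z' ^ N"] by simp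
  moreover have "h (1 + eps - z ^ N) \<noteq> 0" using h_nonzero shifted_disc_bounds(1)[OF zN(1)] by (simp add: less_imp_le)
  ultimately show "z = z'" using eq by simp
qed

end

section \<open>Degree, size and boundary length of the star map\<close>

lemma coprime_if_no_common_root:
  fixes P Q :: "complex poly"
  assumes "Q \<noteq> 0" "\<And>z. poly P z = 0 \<Longrightarrow> poly Q z \<noteq> 0"
  shows "coprime P Q"
proof (rule coprimeI)
  fix c assume c: "c dvd P" "c dvd Q"
  have "c \<noteq> 0" using c(2) assms(1) by auto
  moreover have "degree c = 0"
  proof (rule ccontr)
    assume "degree c \<noteq> 0"
    then have "\<not> constant (poly c)" by (simp add: constant_degree)
    then obtain z where "poly c z = 0" using fundamental_theorem_of_algebra by blast
    with c have "poly P z = 0" "poly Q z = 0" by (meson dvd_trans poly_eq_0_iff_dvd)+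
    with assms(2) show False by blast
  qed
  ultimately show "is_unit c" by (simp add: is_unit_iff_degree)
qed

lemma norm_diff_le_integral_norm_deriv:
  assumes U: "open U" "sphere 0 1 \<subseteq> U" and R: "R holomorphic_on U" and uv: "u \<le> v"
  shows "cmod (R (cis v) - R (cis u)) \<le> integral {u..v} (\<lambda>t. cmod (deriv R (cis t)))"
proof -
  have c: "continuous_on {u..v} (\<lambda>t. deriv R (cis t))"
    using holomorphic_on_imp_continuous_on[OF holomorphic_deriv[OF R U(1)]] U(2)
    by (auto intro!: continuous_on_compose2[of U "deriv R"] continuous_intros)
  have "((\<lambda>t. R (cis t)) has_vector_derivative \<i> * cis t * deriv R (cis t)) (at t within {u..v})" for t
  proof -
    have "(R has_field_derivative deriv R (cis t)) (at (cis t))"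
      using R U by (intro holomorphic_derivI) auto
    moreover have "(cis has_vector_derivative \<i> * cis t) (at t within {u..v})"
      unfolding has_vector_derivative_def by (auto intro!: derivative_eq_intros simp: scaleR_conv_of_real)
    ultimately show ?thesis
      using field_vector_diff_chain_within[of cis "\<i> * cis t" t "{u..v}" R] by (simp add: o_def has_field_derivative_at_within)
  qed
  then have "((\<lambda>t. \<i> * cis t * deriv R (cis t)) has_integral R (cis v) - R (cis u)) {u..v}"
    by (intro fundamental_theorem_of_calculus uv)
  then have "R (cis v) - R (cis u) = integral {u..v} (\<lambda>t. \<i> * cis t * deriv R (cis t))"
    and i: "(\<lambda>t. \<i> * cis t * deriv R (cis t)) integrable_on {u..v}"
    by (auto simp: integral_unique integrable_on_def)
  moreover have "norm (integral {u..v} (\<lambda>t. \<i> * cis t * deriv R (cis t))) \<le> integral {u..v} (\<lambda>t. cmod (deriv R (cis t)))"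
    by (rule integral_norm_bound_integral[OF i]) (use c in \<open>auto intro!: integrable_continuous_interval continuous_intros simp: norm_mult\<close>)
  ultimately show ?thesis by simp
qed

context spikes
begin

definition P :: "complex poly" where
  "P = smult (of_real (1 / exp 8)) ([:0, 1:] * (\<Prod>j<64 * N. [:of_real (1 + eps + a j):] - monom 1 N))"

definition Q :: "complex poly" where
  "Q = (\<Prod>j<64 * N. [:of_real (1 + eps + b j):] - monom 1 N)"

lemma poly_Q: "poly Q z = (\<Prod>j<64 * N. of_real (1 + eps + b j) - z ^ N)"
  by (simp add: Q_def poly_prod poly_monom)

lemma poly_P: "poly P z = z * (\<Prod>j<64 * N. of_real (1 + eps + a j) - z ^ N) / of_real (exp 8)"
  by (simp add: P_def poly_prod poly_monom)

lemma degree_PQ: "degree P \<le> 64 * N\<^sup>2 + 1" "degree Q \<le> 64 * N\<^sup>2"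
proof -
  have "degree ([:c:] - monom 1 N) \<le> N" for c :: complex
    by (rule degree_diff_le) (auto simp: degree_monom_le)
  note deg = this
  have d: "degree (\<Prod>j<64 * N. [:c j:] - monom 1 N) \<le> 64 * N\<^sup>2" for c :: "nat \<Rightarrow> complex"
  proof -
    have "degree (\<Prod>j<64 * N. [:c j:] - monom 1 N) \<le> (\<Sum>j<64 * N. degree ([:c j:] - monom 1 N))"
      using degree_prod_sum_le[of "{..<64 * N}" "\<lambda>j. [:c j:] - monom 1 N"] by (simp add: o_def)
    also have "\<dots> \<le> of_nat (card {..<64 * N}) * N" by (rule sum_bounded_above) (rule deg)
    finally show ?thesis by (simp add: power2_eq_square)
  qed
  show "degree Q \<le> 64 * N\<^sup>2" unfolding Q_def by (rule d)
  have "degree P \<le> degree ([:0, 1:] * (\<Prod>j<64 * N. [:of_real (1 + eps + a j):] - monom 1 N) :: complex poly)"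
    unfolding P_def by (rule degree_smult_le)
  also have "\<dots> \<le> degree [:0, 1 :: complex:] + degree (\<Prod>j<64 * N. [:complex_of_real (1 + eps + a j):] - monom 1 N)"
    by (rule degree_mult_le)
  also have "\<dots> \<le> 1 + 64 * N\<^sup>2" by (intro add_mono d) simp
  finally show "degree P \<le> 64 * N\<^sup>2 + 1" by simp
qed

lemma poly_Q_nonzero: "norm z \<le> 1 \<Longrightarrow> poly Q z \<noteq> 0"
proof -
  assume "norm z \<le> 1"
  then have "norm (z ^ N) \<le> 1" by (simp add: norm_power power_le_one)
  moreover have "norm (complex_of_real (1 + eps + b j)) > 1" for j
    unfolding norm_of_real using eps b_pos[of j] by simp
  ultimately have "complex_of_real (1 + eps + b j) - z ^ N \<noteq> 0" for j
    by (metis eq_iff_diff_eq_0 not_le)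
  then show ?thesis unfolding poly_Q by (simp add: prod_zero_iff del: of_real_add)
qed

lemma star_map_eq: "star_map = (\<lambda>z. poly P z / poly Q z)"
proof
  fix z
  have "h (of_real (1 + eps) - z ^ N) = (\<Prod>j<64 * N. of_real (1 + eps + a j) - z ^ N) / poly Q z"
    unfolding h_def poly_Q prod_dividef [symmetric] by (simp add: algebra_simps)
  then show "star_map z = poly P z / poly Q z" by (simp add: star_map_def poly_P)
qed

lemma a_neq_b: "a j \<noteq> b i"
proof -
  have s: "b j < a j" "a j < b (Suc j)"
    using b_pos[of j] N unfolding a_def b_bounds(3) by (auto simp: field_simps)
  have mono: "b k \<le> b l" if "k \<le> l" for k l
    unfolding b_def using eps that by (intro mult_left_mono power_increasing) auto
  show ?thesis using s mono[of i j] mono[of "Suc j" i] by (cases "i \<le> j") auto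
qed

lemma coprime_PQ: "coprime P Q"
proof (rule coprime_if_no_common_root)
  show "Q \<noteq> 0" using poly_Q_nonzero[of 0] by auto
  fix z assume "poly P z = 0"
  then have "z = 0 \<or> (\<exists>j. z ^ N = of_real (1 + eps + a j))"
    unfolding poly_P by (simp add: prod_zero_iff del: of_real_add) (metis eq_iff_diff_eq_0)
  then show "poly Q z \<noteq> 0"
  proof
    assume "\<exists>j. z ^ N = of_real (1 + eps + a j)"
    then obtain j where j: "z ^ N = of_real (1 + eps + a j)" ..
    have "complex_of_real (1 + eps + b i) - of_real (1 + eps + a j) = of_real (b i - a j)" for i by simp
    then show ?thesis unfolding poly_Q j using a_neq_b[of j, symmetric] by (auto simp: prod_zero_iff simp del: of_real_add)
  qed (use poly_Q_nonzero in auto)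
qed

text \<open>In the right half-plane each of the \<open>64 * N\<close> factors is at most \<open>1 + 1 / (8 * N)\<close> in modulus.\<close>

lemma norm_h_le:
  assumes x: "Re x \<ge> 0"
  shows "norm (h x) \<le> exp 8"
proof -
  have f: "norm ((x + of_real (a j)) / (x + of_real (b j))) \<le> exp (1 / (8 * N))" for j
  proof -
    have "norm (x + of_real (a j)) \<le> norm (x + of_real (b j)) + norm (complex_of_real (a j - b j))"
      using norm_triangle_ineq[of "x + of_real (b j)" "of_real (a j - b j)"] by simp
    also have "norm (complex_of_real (a j - b j)) = b j * (1 / (8 * N))"
      unfolding norm_of_real using a_bounds(1)[of j] b_pos[of j] by (simp add: a_def algebra_simps)
    also have "\<dots> \<le> norm (x + of_real (b j)) * (1 / (8 * N))"
      using norm_add_of_real_ge(2)[OF x, of "b j"] b_pos[of j] by (intro mult_right_mono) auto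
    also have "norm (x + of_real (b j)) + norm (x + of_real (b j)) * (1 / (8 * N)) = (1 + 1 / (8 * N)) * norm (x + of_real (b j))"
      by (simp add: algebra_simps)
    also have "\<dots> \<le> exp (1 / (8 * N)) * norm (x + of_real (b j))"
      by (intro mult_right_mono exp_ge_add_one_self) auto
    finally show ?thesis using denominators_nonzero(1)[OF x, of j] by (simp add: norm_divide pos_divide_le_eq)
  qed
  have "norm (h x) \<le> (\<Prod>j<64 * N. exp (1 / (8 * N)))"
    unfolding h_def prod_norm[symmetric] by (intro prod_mono) (use f in auto)
  also have "\<dots> = exp (real (64 * N) * (1 / (8 * N)))" by (simp only: prod_constant card_lessThan exp_of_nat_mult)
  also have "real (64 * N) * (1 / (8 * N)) = 8" using N by simp
  finally show ?thesis .
qed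

lemma star_map_RU1:
  assumes "64 * N\<^sup>2 + 1 \<le> n"
  shows "star_map \<in> RU1 n"
proof -
  define U where "U = {z. poly Q z \<noteq> 0}"
  have U: "open U" "cball 0 1 \<subseteq> U"
    unfolding U_def using poly_Q_nonzero by (auto intro!: open_Collect_neq continuous_intros)
  have hol: "star_map holomorphic_on U" unfolding star_map_eq U_def by (intro holomorphic_intros) auto
  have "rational_fun_of_degree_le n star_map"
    unfolding rational_fun_of_degree_le_def
    by (intro exI[of _ P] exI[of _ Q]) (use coprime_PQ degree_PQ assms star_map_eq poly_Q_nonzero[of 0] in auto)
  moreover have "\<not> is_pole star_map z" if "z \<in> cball 0 1" for z
    by (rule not_is_pole_holomorphic[OF U(1) _ hol]) (use that U in auto)
  moreover have "(SUP \<zeta>\<in>sphere 0 1. cmod (star_map \<zeta>)) \<le> 1"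
  proof (rule cSUP_least)
    fix z :: complex assume z: "z \<in> sphere 0 1"
    then have "Re (z ^ N) \<le> 1" using complex_Re_le_cmod[of "z ^ N"] by (simp add: norm_power)
    then have "norm (h (of_real (1 + eps) - z ^ N)) \<le> exp 8" using eps by (intro norm_h_le) simp
    then show "cmod (star_map z) \<le> 1" using z by (simp add: star_map_def norm_mult norm_divide)
  qed (use ex_in_conv in \<open>auto intro!: exI[of _ 1]\<close>)
  ultimately show ?thesis using inj_on_star_map by (auto simp: RU1_def)
qed

lemma norm_factor_nonneg:
  assumes "u \<ge> 0"
  shows "norm ((of_real u + complex_of_real (a j)) / (of_real u + of_real (b j))) = 1 + b j / (u + b j) / (8 * N)"
proof -
  have pos: "u + b j > 0" "u + a j > 0" using assms a_pos[of j] b_pos[of j] by auto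
  have "(of_real u + complex_of_real (a j)) / (of_real u + of_real (b j)) = of_real ((u + a j) / (u + b j))"
    by simp
  then have "norm ((of_real u + complex_of_real (a j)) / (of_real u + of_real (b j))) = (u + a j) / (u + b j)"
    using pos by (simp only: norm_of_real) simp
  also have "u + a j = (u + b j) + b j / (8 * N)" by (simp add: a_def algebra_simps)
  also have "\<dots> / (u + b j) = 1 + b j / (u + b j) / (8 * N)" using pos by (simp add: add_divide_distrib)
  finally show ?thesis .
qed

text \<open>At the tips of the spikes \<open>z ^ N = 1\<close>, that is, \<open>x = eps\<close>.  All factors with \<open>b j \<ge> eps\<close>, which holds from \<open>j = 18\<close>
  on because \<open>(9/8)^18 \<ge> 8\<close>, are at least \<open>1 + 1 / (16 * N)\<close>.\<close>

lemma norm_h_tip: "norm (h (of_real eps)) \<ge> 4"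
proof -
  have f: "norm ((of_real eps + complex_of_real (a j)) / (of_real eps + of_real (b j))) \<ge> (if j < 18 then 1 else 1 + 1 / (16 * N))" for j
  proof -
    have "norm ((of_real eps + complex_of_real (a j)) / (of_real eps + of_real (b j))) = 1 + b j / (eps + b j) / (8 * N)"
      using eps by (intro norm_factor_nonneg) simp
    also have "\<dots> \<ge> (if j < 18 then 1 else 1 + 1 / (16 * N))"
    proof (cases "j < 18")
      case False
      have "(8::real) \<le> (9/8) ^ 18" by (simp add: power_divide)
      also have "\<dots> \<le> (9/8) ^ j" using False by (intro power_increasing) auto
      finally have "eps \<le> b j" unfolding b_def using eps mult_left_mono[of 8 "(9/8)^j" "eps / 8"] by simp
      then have "1 / 2 \<le> b j / (eps + b j)" using eps by (simp add: field_simps)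
      then have "1 / 2 / (8 * N) \<le> b j / (eps + b j) / (8 * N)" by (intro divide_right_mono) auto
      with False show ?thesis by simp
    qed (use eps b_pos[of j] in auto)
    finally show ?thesis .
  qed
  have "4 \<le> 1 + real (64 * N - 18) * (1 / (16 * N))"
  proof -
    have "real (64 * N - 18) * (1 / (16 * N)) = 4 - 18 / (16 * N)" using N by (simp add: of_nat_diff diff_divide_distrib)
    moreover have "18 / (16 * real N) \<le> 1" using N by simp
    ultimately show ?thesis by linarith
  qed
  also have "\<dots> \<le> (1 + 1 / (16 * N)) ^ (64 * N - 18)" by (rule Bernoulli_inequality) (rule order_trans[of _ 0], auto)
  also have "\<dots> = (\<Prod>j<64 * N. if j < 18 then 1 else 1 + 1 / (16 * N))"
  proof -
    have "{..<64 * N} \<inter> {j. j < 18} = {..<18}" "{..<64 * N} \<inter> - {j. j < 18} = {18..<64 * N}" using N by auto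
    then show ?thesis by (simp add: prod.If_cases)
  qed
  also have "\<dots> \<le> norm (h (of_real eps))"
    unfolding h_def prod_norm[symmetric] by (intro prod_mono) (use f in auto)
  finally show ?thesis .
qed

text \<open>Halfway between two spikes \<open>z ^ N = - 1\<close>, that is, \<open>x = 2 + eps\<close>.  The
  \<open>j\<close>-th factor exceeds 1 by at most \<open>b j / (16 * N)\<close>, and the geometric sum of the \<open>b j\<close> is at most \<open>8 * 24\<close>.\<close>

lemma norm_h_valley: "norm (h (of_real (2 + eps))) \<le> 3"
proof -
  have f: "norm ((of_real (2 + eps) + complex_of_real (a j)) / (of_real (2 + eps) + of_real (b j))) \<le> exp (b j / (16 * N))" for j
  proof -
    have "norm ((of_real (2 + eps) + complex_of_real (a j)) / (of_real (2 + eps) + of_real (b j))) = 1 + b j / (2 + eps + b j) / (8 * N)"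
      using eps by (intro norm_factor_nonneg) simp
    also have "\<dots> \<le> 1 + b j / 2 / (8 * N)"
      using eps b_pos[of j] N by (intro add_mono divide_right_mono divide_left_mono) auto
    also have "\<dots> \<le> exp (b j / (16 * N))" using exp_ge_add_one_self[of "b j / (16 * N)"] by simp
    finally show ?thesis .
  qed
  have "norm (h (of_real (2 + eps))) \<le> (\<Prod>j<64 * N. exp (b j / (16 * N)))"
    unfolding h_def prod_norm[symmetric] by (intro prod_mono) (use f in auto)
  also have "\<dots> = exp ((\<Sum>j<64 * N. b j) / (16 * N))" by (simp add: exp_sum sum_divide_distrib)
  also have "(\<Sum>j<64 * N. b j) = 8 * (\<Sum>j<64 * N. b (Suc j) - b j)"
    unfolding b_bounds(3) sum_distrib_left by (intro sum.cong) auto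
  also have "(\<Sum>j<64 * N. b (Suc j) - b j) = 24 - eps / 8" by (simp only: sum_lessThan_telescope b_bounds(1,2))
  also have "exp (8 * (24 - eps / 8) / (16 * N)) \<le> exp 1"
    using N eps by (simp add: field_simps)
  also have "\<dots> \<le> 3" by (rule exp_le)
  finally show ?thesis .
qed

text \<open>On each of the \<open>N\<close> arcs between consecutive tips the boundary curve descends from a tip to a valley, so its
  length there is at least the difference \<open>4 / exp 8 - 3 / exp 8\<close> of the moduli.\<close>

lemma ell_star_map_ge: "ell star_map \<ge> N / (2 * pi * exp 8)"
proof -
  define U where "U = {z. poly Q z \<noteq> 0}"
  have U: "open U" "sphere 0 1 \<subseteq> U"
    unfolding U_def using poly_Q_nonzero by (auto intro!: open_Collect_neq continuous_intros)
  have hol: "star_map holomorphic_on U" unfolding star_map_eq U_def by (intro holomorphic_intros) auto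
  define f where "f = (\<lambda>t. cmod (deriv star_map (cis t)))"
  define c where "c = 2 * pi / N"
  have c: "c > 0" "N * c = 2 * pi" using N by (auto simp: c_def)
  have contf: "continuous_on A f" for A
    unfolding f_def using holomorphic_on_imp_continuous_on[OF holomorphic_deriv[OF hol U(1)]] U(2)
    by (auto intro!: continuous_on_compose2[of U "deriv star_map"] continuous_intros)
  have intf: "f integrable_on {u..v}" for u v by (intro integrable_continuous_interval contf)
  have tip: "cmod (star_map (cis (k * c))) \<ge> 4 / exp 8" for k :: nat
  proof -
    have "cis (k * c) ^ N = cis (2 * pi * k)" using N by (simp add: Complex.DeMoivre c_def mult_ac)
    also have "\<dots> = 1" by (metis cis_2pi Complex.DeMoivre mult.commute power_one)
    finally have "star_map (cis (k * c)) = cis (k * c) * h (of_real eps) / of_real (exp 8)" by (simp add: star_map_def)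
    then show ?thesis using norm_h_tip by (simp add: norm_mult norm_divide divide_right_mono)
  qed
  have valley: "cmod (star_map (cis (k * c + c / 2))) \<le> 3 / exp 8" for k :: nat
  proof -
    have "cis (k * c + c / 2) ^ N = cis (2 * pi * k + pi)" using N by (simp add: Complex.DeMoivre c_def algebra_simps)
    also have "\<dots> = cis (2 * pi * k) * cis pi" by (rule cis_mult[symmetric])
    also have "cis (2 * pi * k) = 1" by (metis cis_2pi Complex.DeMoivre mult.commute power_one)
    finally have "star_map (cis (k * c + c / 2)) = cis (k * c + c / 2) * h (of_real (2 + eps)) / of_real (exp 8)"
      by (simp add: star_map_def)
    then show ?thesis using norm_h_valley by (simp add: norm_mult norm_divide divide_right_mono)
  qed
  have "k / exp 8 \<le> integral {0..k * c} f" for k :: nat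
  proof (induction k)
    case (Suc k)
    have "1 / exp 8 = 4 / exp 8 - 3 / exp (8 :: real)" by (simp add: field_simps)
    also have "\<dots> \<le> cmod (star_map (cis (k * c))) - cmod (star_map (cis (k * c + c / 2)))"
      by (intro diff_mono tip valley)
    also have "\<dots> \<le> cmod (star_map (cis (k * c + c / 2)) - star_map (cis (k * c)))" by (metis norm_minus_commute norm_triangle_ineq2)
    also have "\<dots> \<le> integral {k * c..k * c + c / 2} f"
      unfolding f_def using c by (intro norm_diff_le_integral_norm_deriv[OF U hol]) auto
    also have "\<dots> \<le> integral {k * c..Suc k * c} f"
      using c by (intro integral_subset_le intf) (auto simp: f_def algebra_simps)
    finally have "Suc k / exp 8 \<le> integral {0..k * c} f + integral {k * c..Suc k * c} f"
      using Suc by (simp add: add_divide_distrib)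
    also have "\<dots> = integral {0..Suc k * c} f"
      using c by (intro Henstock_Kurzweil_Integration.integral_combine intf) (auto simp: algebra_simps)
    finally show ?case .
  qed simp
  from this[of N] have "N / exp 8 \<le> integral {0..2 * pi} f" unfolding c .
  then show ?thesis
    unfolding ell_def f_def by (simp add: field_simps)
qed

end

section \<open>The supremum and the exponent\<close>

lemma identity_RU1:
  assumes "n \<ge> 1" shows "(\<lambda>z. z) \<in> RU1 n"
proof -
  have "rational_fun_of_degree_le n (\<lambda>z. z)"
    unfolding rational_fun_of_degree_le_def
    by (rule exI[of _ "[:0, 1:]"], rule exI[of _ 1]) (use assms in \<open>auto simp: fun_eq_iff\<close>)
  moreover have "\<not> is_pole (\<lambda>z::complex. z) z" for z
    by (rule not_is_pole_holomorphic[of UNIV]) (auto intro: holomorphic_intros)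
  moreover have "(SUP \<zeta>\<in>sphere 0 1. cmod \<zeta>) \<le> 1"
    by (rule cSUP_least) (auto intro: exI[of _ 1])
  ultimately show ?thesis by (simp add: RU1_def)
qed

lemma ell_identity: "ell (\<lambda>z. z) = 1"
  by (simp add: ell_def)

text \<open>For large \<open>n\<close> take the star with \<open>N\<close> about \<open>sqrt n / 9\<close> spikes, where 9 is chosen so that
  \<open>64 * N^2 + 1 \<le> n\<close>.  For small \<open>n\<close> the identity is long enough.\<close>

lemma exists_RU1_ell_ge:
  assumes n: "n \<ge> 1"
  shows "\<exists>R\<in>RU1 n. 1 / (36 * pi * exp 8) * sqrt n \<le> ell R"
proof (cases "sqrt n \<ge> 108")
  case True
  define N where "N = nat \<lfloor>sqrt n / 9\<rfloor>"
  have N_bounds: "real N \<le> sqrt n / 9" "sqrt n / 9 - 1 < real N"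
    unfolding N_def using True by (auto simp: of_nat_nat) linarith+
  have "real N > 11" using N_bounds(2) True by linarith
  then have "N \<ge> 12" by linarith
  then interpret spikes N by unfold_locales
  have "(real N)\<^sup>2 \<le> (sqrt n / 9)\<^sup>2" using N_bounds by (intro power_mono) auto
  also have "\<dots> = n / 81" by (simp add: power_divide)
  finally have "64 * (real N)\<^sup>2 \<le> 64 / 81 * n" by simp
  moreover have "1 \<le> 17 / 81 * real n"
  proof -
    have "108\<^sup>2 \<le> (sqrt n)\<^sup>2" using True by (intro power_mono) auto
    then show ?thesis by simp
  qed
  ultimately have "64 * (real N)\<^sup>2 + 1 \<le> n" by linarith
  then have "real (64 * N\<^sup>2 + 1) \<le> real n" by simp
  then have "star_map \<in> RU1 n" by (intro star_map_RU1) linarith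
  moreover have "1 / (36 * pi * exp 8) * sqrt n \<le> ell star_map"
  proof -
    have "sqrt n / 18 \<le> N" using N_bounds(2) True by linarith
    then have "sqrt n / 18 / (2 * pi * exp 8) \<le> N / (2 * pi * exp 8)" by (intro divide_right_mono) auto
    also have "\<dots> \<le> ell star_map" by (rule ell_star_map_ge)
    finally show ?thesis by (simp add: mult_ac)
  qed
  ultimately show ?thesis by blast
next
  case False
  have "36 * 3 * 1 \<le> 36 * pi * exp (8::real)" using pi_gt3 by (intro mult_mono) auto
  then have "sqrt n \<le> 36 * pi * exp 8" using False by simp
  then have "1 / (36 * pi * exp 8) * sqrt n \<le> 1" by simp
  then show ?thesis using identity_RU1[OF n] ell_identity by (intro bexI[of _ "\<lambda>z. z"]) auto
qed

lemma ell_le_six_pi_sqrt: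
  assumes "R \<in> RU1 n" "n \<ge> 1"
  shows "ell R \<le> 6 * pi * sqrt n"
proof -
  have "sqrt 32 \<le> sqrt (6\<^sup>2)" by (subst real_sqrt_le_iff) simp
  also have "\<dots> \<le> 6 * pi" using pi_gt3 by simp
  finally have "sqrt 32 * sqrt n \<le> 6 * pi * sqrt n" by (intro mult_right_mono) auto
  with ell_le_sqrt[OF assms] show ?thesis by (simp add: real_sqrt_mult)
qed

lemma tendsto_ln_sqrt_over_ln:
  assumes "c > 0"
  shows "(\<lambda>n. ln (c * sqrt (real n)) / ln (real n)) \<longlonglongrightarrow> 1 / 2"
proof -
  have ln: "filterlim (\<lambda>n. ln (real n)) at_top sequentially"
    by (rule filterlim_compose[OF ln_at_top filterlim_real_sequentially])
  have "(\<lambda>n. ln c / ln (real n) + 1 / 2) \<longlonglongrightarrow> 0 + 1 / 2"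
    by (intro tendsto_add real_tendsto_divide_at_top[OF tendsto_const ln] tendsto_const)
  moreover have "\<forall>\<^sub>F n in sequentially. ln c / ln (real n) + 1 / 2 = ln (c * sqrt (real n)) / ln (real n)"
    using eventually_gt_at_top[of 1]
  proof eventually_elim
    case (elim n)
    then have "ln (real n) > 0" by simp
    then show ?case using elim assms by (simp add: ln_mult ln_sqrt field_simps)
  qed
  ultimately show ?thesis by (simp add: filterlim_cong)
qed

lemma gamma0_eq: "gamma0 = ereal (1 / 2)"
proof -
  define s where "s = (\<lambda>n. SUP R\<in>RU1 n. ereal (ln (ell R) / ln (real n)))"
  define \<alpha> :: real where "\<alpha> = 1 / (36 * pi * exp 8)"
  have \<alpha>: "\<alpha> > 0" by (simp add: \<alpha>_def)
  have lower: "\<forall>\<^sub>F n in sequentially. ereal (ln (\<alpha> * sqrt n) / ln n) \<le> s n"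
    using eventually_gt_at_top[of 1]
  proof eventually_elim
    case (elim n)
    then obtain R where R: "R \<in> RU1 n" "\<alpha> * sqrt n \<le> ell R"
      using exists_RU1_ell_ge[of n] by (auto simp: \<alpha>_def)
    have "0 < \<alpha> * sqrt n" using \<alpha> elim by simp
    with R(2) have "ln (\<alpha> * sqrt n) \<le> ln (ell R)" by (intro ln_mono) auto
    then have "ereal (ln (\<alpha> * sqrt n) / ln n) \<le> ereal (ln (ell R) / ln n)"
      using elim by (simp add: divide_right_mono)
    also have "\<dots> \<le> s n" unfolding s_def using R(1) by (intro SUP_upper)
    finally show ?case .
  qed
  have upper: "\<forall>\<^sub>F n in sequentially. s n \<le> ereal (ln (6 * pi * sqrt n) / ln n)"
    using eventually_gt_at_top[of 1]
  proof eventually_elim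
    case (elim n)
    have ge1: "1 \<le> 6 * pi * sqrt n"
      using pi_gt3 elim mult_mono[of 1 "6 * pi" 1 "sqrt n"] by simp
    show ?case unfolding s_def
    proof (rule SUP_least)
      fix R assume R: "R \<in> RU1 n"
      have "ln (ell R) \<le> ln (6 * pi * sqrt n)"
      \<comment> \<open>For \<open>ell R = 0\<close> the logarithm takes the value \<open>ln 0 = 0\<close>, which is below the bound as well.\<close>
      proof (cases "ell R = 0")
        case False
        moreover have "ell R \<ge> 0"
          unfolding ell_def
          by (cases "(\<lambda>t. cmod (deriv R (cis t))) integrable_on {0..2 * pi}")
             (simp_all add: Henstock_Kurzweil_Integration.integral_nonneg not_integrable_integral)
        ultimately show ?thesis using ell_le_six_pi_sqrt[OF R] elim by (intro ln_mono) auto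
      qed (use ge1 in simp)
      then show "ereal (ln (ell R) / ln n) \<le> ereal (ln (6 * pi * sqrt n) / ln n)"
        using elim by (simp add: divide_right_mono)
    qed
  qed
  have "s \<longlonglongrightarrow> ereal (1 / 2)"
    by (rule tendsto_sandwich[OF lower upper]) (intro tendsto_ereal tendsto_ln_sqrt_over_ln; use \<alpha> in simp)+
  then show ?thesis
    unfolding gamma0_def s_def[symmetric] by (intro lim_imp_Limsup) auto
qed

theorem theorem2:
  "(\<exists>\<alpha>::real. \<alpha> > 0 \<and>
      (\<forall>n::nat. n \<ge> 1 \<longrightarrow>
         ereal (\<alpha> * sqrt (real n)) \<le> (SUP R\<in>RU1 n. ereal (ell R)) \<and>
         (SUP R\<in>RU1 n. ereal (ell R)) \<le> ereal (6 * pi * sqrt (real n)))) \<and>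
   gamma0 = ereal (1 / 2)"
proof (intro conjI exI[of _ "1 / (36 * pi * exp 8)"] allI impI)
  show "0 < 1 / (36 * pi * exp (8::real))" by simp
next
  fix n :: nat assume "n \<ge> 1"
  then obtain R where "R \<in> RU1 n" "1 / (36 * pi * exp 8) * sqrt n \<le> ell R"
    using exists_RU1_ell_ge by blast
  then show "ereal (1 / (36 * pi * exp 8) * sqrt n) \<le> (SUP R\<in>RU1 n. ereal (ell R))"
    by (intro SUP_upper2[of R]) simp_all
next
  fix n :: nat assume "n \<ge> 1"
  then show "(SUP R\<in>RU1 n. ereal (ell R)) \<le> ereal (6 * pi * sqrt n)"
    by (intro SUP_least) (simp add: ell_le_six_pi_sqrt)
qed (rule gamma0_eq)

end
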